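(* Let $q_0\in M$, $t_1>0$. For any $q_1\in\mathcal{A}_{q_0}(t_1)$, the corresponding optimal control for Euler's elastic problem (with data $q_0,q_1,t_1$) is essentially bounded.
   Context: Let $M=\mathbb{R}^2_{x,y}\times S^1_\theta$, $S^1=\mathbb{R}/2\pi\mathbb{Z}$. Euler's elastic problem with data $q_0,q_1\in M$, $t_1>0$ is the optimal control problem $$\dot x=\cos\theta,\quad \dot y=\sin\theta,\quad \dot\theta=u,\qquad q=(x,y,\theta)\in M,\ u\in\mathbb{R},$$ $$q(0)=q_0,\quad q(t_1)=q_1,\quad t_1 \text{ fixed},\qquad J=\frac12\int_0^{t_1}u^2(t)\,dt\to\min,$$ with controls $u\in L_2[0,t_1]$ and absolutely continuous trajectories. $\mathcal{A}_{q_0}(t_1)$ denotes the set of endpoints $q(t_1)$ of all trajectories with $q(0)=q_0$ corresponding to controls $u\in L_2[0,t_1]$. *)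

theory Defs
  imports "HOL-Analysis.Analysis"
begin

quotient_type circle = real / "\<lambda>a b. \<exists>k::int. a - b = 2 * pi * of_int k"
  morphisms circle_rep angle
proof (rule equivpI)
  show "reflp (\<lambda>a b. \<exists>k::int. a - b = 2 * pi * of_int k)"
    by (rule reflpI) (rule exI[of _ 0], simp)
  show "symp (\<lambda>a b. \<exists>k::int. a - b = 2 * pi * of_int k)"
  proof (rule sympI)
    fix a b :: real
    assume "\<exists>k::int. a - b = 2 * pi * of_int k"
    then obtain k :: int where "a - b = 2 * pi * of_int k" ..
    then have "b - a = 2 * pi * of_int (- k)" by simp
    then show "\<exists>k::int. b - a = 2 * pi * of_int k" ..
  qed
  show "transp (\<lambda>a b. \<exists>k::int. a - b = 2 * pi * of_int k)"
  proof (rule transpI)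
    fix a b c :: real
    assume "\<exists>k::int. a - b = 2 * pi * of_int k" "\<exists>k::int. b - c = 2 * pi * of_int k"
    then obtain k l :: int
      where "a - b = 2 * pi * of_int k" "b - c = 2 * pi * of_int l" by blast
    then have "a - c = 2 * pi * of_int (k + l)" by (simp add: algebra_simps)
    then show "\<exists>k::int. a - c = 2 * pi * of_int k" ..
  qed
qed

lemma angle_eq_iff: "angle a = angle b \<longleftrightarrow> (\<exists>k::int. a - b = 2 * pi * of_int k)"
  by (rule circle.abs_eq_iff)

type_synonym config = "real \<times> real \<times> circle"

(* Every finite family of non-overlapping closed subintervals of S is a division of its union;
   the endpoints of a nonempty interval K = {a..b} are a = Inf K and b = Sup K. *)
definition absolutely_continuous_on :: "real set \<Rightarrow> (real \<Rightarrow> real) \<Rightarrow> bool" where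
  "absolutely_continuous_on S f \<longleftrightarrow>
    (\<forall>\<epsilon>>0. \<exists>\<delta>>0. \<forall>D. D division_of \<Union>D \<and> \<Union>D \<subseteq> S \<and> (\<Sum>K\<in>D. Sup K - Inf K) < \<delta> \<longrightarrow>
      (\<Sum>K\<in>D. \<bar>f (Sup K) - f (Inf K)\<bar>) < \<epsilon>)"

definition L2_control :: "real \<Rightarrow> (real \<Rightarrow> real) \<Rightarrow> bool" where
  "L2_control t1 u \<longleftrightarrow>
    u \<in> borel_measurable (lebesgue_on {0..t1}) \<and>
    integrable (lebesgue_on {0..t1}) (\<lambda>t. (u t)\<^sup>2)"

(* The projection angle from the real line to the circle is a covering map and a local isometry,
   so the absolutely continuous curves in the circle over {0..t1} are the curves angle o \<theta>
   with \<theta> absolutely continuous; their velocity is the derivative of \<theta>.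
   The values of u and q outside {0..t1} play no role. *)
definition trajectory :: "real \<Rightarrow> (real \<Rightarrow> real) \<Rightarrow> (real \<Rightarrow> config) \<Rightarrow> bool" where
  "trajectory t1 u q \<longleftrightarrow>
    (\<exists>x y \<theta>.
      (\<forall>t\<in>{0..t1}. q t = (x t, y t, angle (\<theta> t))) \<and>
      absolutely_continuous_on {0..t1} x \<and>
      absolutely_continuous_on {0..t1} y \<and>
      absolutely_continuous_on {0..t1} \<theta> \<and>
      (AE t in lebesgue_on {0..t1}.
        (x has_real_derivative cos (\<theta> t)) (at t within {0..t1}) \<and>
        (y has_real_derivative sin (\<theta> t)) (at t within {0..t1}) \<and>
        (\<theta> has_real_derivative u t) (at t within {0..t1})))"

definition admissible_control :: "config \<Rightarrow> config \<Rightarrow> real \<Rightarrow> (real \<Rightarrow> real) \<Rightarrow> bool" where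
  "admissible_control q0 q1 t1 u \<longleftrightarrow>
    L2_control t1 u \<and> (\<exists>q. trajectory t1 u q \<and> q 0 = q0 \<and> q t1 = q1)"

definition attainable_set :: "config \<Rightarrow> real \<Rightarrow> config set" where
  "attainable_set q0 t1 =
    {q t1 | q u. L2_control t1 u \<and> trajectory t1 u q \<and> q 0 = q0}"

definition elastic_energy :: "real \<Rightarrow> (real \<Rightarrow> real) \<Rightarrow> real" where
  "elastic_energy t1 u = 1/2 * (LINT t|lebesgue_on {0..t1}. (u t)\<^sup>2)"

definition optimal_control :: "config \<Rightarrow> config \<Rightarrow> real \<Rightarrow> (real \<Rightarrow> real) \<Rightarrow> bool" where
  "optimal_control q0 q1 t1 u \<longleftrightarrow>
    admissible_control q0 q1 t1 u \<and>
    (\<forall>v. admissible_control q0 q1 t1 v \<longrightarrow> elastic_energy t1 u \<le> elastic_energy t1 v)"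

definition essentially_bounded :: "real \<Rightarrow> (real \<Rightarrow> real) \<Rightarrow> bool" where
  "essentially_bounded t1 u \<longleftrightarrow> (\<exists>C. AE t in lebesgue_on {0..t1}. \<bar>u t\<bar> \<le> C)"

end

theory Submission
  imports Defs
begin

text \<open>
  Let \<open>u\<close> be optimal and let \<open>\<theta>\<close> be a continuous lift of the angle along the
  corresponding trajectory. Keep the endpoints of \<open>\<theta>\<close> and perturb
  \<open>\<theta>\<close> to \<open>\<theta> + \<phi>\<close>, where \<open>\<phi>\<close> is Lipschitz
  and vanishes at \<open>0\<close> and \<open>t1\<close>. The result is admissible as soon as two scalar
  conditions hold: the integrals of \<open>cos \<theta>\<close> and \<open>sin \<theta>\<close> must not
  change. Optimality is thus a constrained minimum with finitely many constraints.

  The triples of first variations of the energy and of the two constraints form a linear subspace of a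
  three-dimensional space. If it were the whole space, a finite-dimensional open mapping argument
  would produce an admissible perturbation of smaller energy
  (\<open>energy_decreasing_perturbation\<close>). Hence there is a nonzero normal vector
  \<open>(l0, l1, l2)\<close>, and with \<open>h = l2 * cos \<theta> - l1 * sin \<theta>\<close> every
  variation \<open>\<phi>\<close> satisfies the weak Euler--Lagrange equation saying that \<open>l0\<close>
  times the integral of \<open>u * \<phi>'\<close> plus the integral of \<open>h * \<phi>\<close> is zero
  (\<open>weak_Euler_Lagrange\<close>).

  Both cases are decided by testing with the Green functions \<open>green t1 s\<close> of the second
  derivative. If \<open>l0 = 0\<close>, then \<open>h\<close> vanishes identically, so the direction
  of motion is constant and \<open>u\<close> is zero almost everywhere. If \<open>l0\<close> is not zero,
  integrating \<open>u\<close> against the derivative of the Green function gives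
  \<open>\<theta> s\<close> up to an affine function of \<open>s\<close>; this uses the fundamental theorem
  of calculus for absolutely continuous functions,
  \<open>has_integral_derivative_absolutely_continuous\<close>. The weak equation then writes
  \<open>\<theta>\<close> as an affine function plus the Green potential of a bounded function, which is
  Lipschitz, and the derivative of a Lipschitz function is bounded.
\<close>

section \<open>Absolutely continuous functions on a real interval\<close>

lemma AE_lebesgue_on_iff_negligible:
  assumes "S \<in> sets lebesgue"
  shows "(AE x in lebesgue_on S. P x) \<longleftrightarrow> negligible {x \<in> S. \<not> P x}"
proof -
  have "(AE x in lebesgue_on S. P x) \<longleftrightarrow> (AE x in lebesgue. x \<in> S \<longrightarrow> P x)"
    using assms by (simp add: AE_restrict_space_iff)
  also have "\<dots> \<longleftrightarrow> {x \<in> S. \<not> P x} \<in> null_sets lebesgue"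
    by (simp add: completion.AE_iff_null_sets Collect_conj_eq conj_commute)
  finally show ?thesis by (simp add: negligible_iff_null_sets)
qed

lemma absolutely_continuous_on_subset:
  assumes "absolutely_continuous_on S f" "T \<subseteq> S"
  shows "absolutely_continuous_on T f"
  using assms unfolding absolutely_continuous_on_def by (meson order_trans)

lemma division_real_interval:
  fixes D :: "real set set"
  assumes "D division_of U" "K \<in> D"
  obtains a b where "K = {a..b}" "a \<le> b" "Inf K = a" "Sup K = b" "a \<in> K" "b \<in> K"
proof -
  obtain a b where "K = cbox a b" "K \<noteq> {}"
    using division_ofD(3,4)[OF assms(1)] assms(2) by metis
  then show ?thesis using that[of a b] by (auto simp: box_real)
qed

lemma absolutely_continuous_on_lipschitz:
  fixes f :: "real \<Rightarrow> real"
  assumes "L-lipschitz_on S f"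
  shows "absolutely_continuous_on S f"
  unfolding absolutely_continuous_on_def
proof (intro allI impI)
  fix \<epsilon> :: real assume "\<epsilon> > 0"
  have L: "L \<ge> 0" using assms by (rule lipschitz_on_nonneg)
  show "\<exists>\<delta>>0. \<forall>D. D division_of \<Union> D \<and> \<Union> D \<subseteq> S \<and> (\<Sum>K\<in>D. Sup K - Inf K) < \<delta> \<longrightarrow>
      (\<Sum>K\<in>D. \<bar>f (Sup K) - f (Inf K)\<bar>) < \<epsilon>"
  proof (intro exI[of _ "\<epsilon> / (L + 1)"] conjI allI impI; (elim conjE)?)
    show "\<epsilon> / (L + 1) > 0" using \<open>\<epsilon> > 0\<close> L by simp
    fix D :: "real set set"
    assume D: "D division_of \<Union> D" "\<Union> D \<subseteq> S" and lt: "(\<Sum>K\<in>D. Sup K - Inf K) < \<epsilon> / (L + 1)"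
    have 0: "(\<Sum>K\<in>D. Sup K - Inf K) \<ge> 0"
      by (rule sum_nonneg) (metis D(1) division_real_interval diff_ge_0_iff_ge)
    have "(\<Sum>K\<in>D. \<bar>f (Sup K) - f (Inf K)\<bar>) \<le> (\<Sum>K\<in>D. L * (Sup K - Inf K))"
    proof (rule sum_mono)
      fix K assume K: "K \<in> D"
      obtain a b where ab: "K = {a..b}" "a \<le> b" "Inf K = a" "Sup K = b" "a \<in> K" "b \<in> K"
        using D(1) K by (rule division_real_interval)
      have "dist (f b) (f a) \<le> L * dist b a"
        using ab K D(2) by (intro lipschitz_onD[OF assms]) blast+
      then show "\<bar>f (Sup K) - f (Inf K)\<bar> \<le> L * (Sup K - Inf K)"
        using ab by (simp add: dist_real_def)
    qed
    also have "\<dots> \<le> (L + 1) * (\<Sum>K\<in>D. Sup K - Inf K)"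
      using 0 unfolding sum_distrib_left[symmetric] by (intro mult_right_mono) auto
    also have "\<dots> < \<epsilon>" using lt L by (simp add: field_simps)
    finally show "(\<Sum>K\<in>D. \<bar>f (Sup K) - f (Inf K)\<bar>) < \<epsilon>" .
  qed
qed

lemma absolutely_continuous_on_add:
  assumes f: "absolutely_continuous_on S f" and g: "absolutely_continuous_on S g"
  shows "absolutely_continuous_on S (\<lambda>x. f x + g x)"
  unfolding absolutely_continuous_on_def
proof (intro allI impI)
  fix \<epsilon> :: real assume "\<epsilon> > 0"
  then have e: "\<epsilon> / 2 > 0" by simp
  obtain d1 where d1: "d1 > 0" "\<And>D. D division_of \<Union>D \<Longrightarrow> \<Union>D \<subseteq> S \<Longrightarrow> (\<Sum>K\<in>D. Sup K - Inf K) < d1 \<Longrightarrow>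
      (\<Sum>K\<in>D. \<bar>f (Sup K) - f (Inf K)\<bar>) < \<epsilon> / 2"
    using f e unfolding absolutely_continuous_on_def by meson
  obtain d2 where d2: "d2 > 0" "\<And>D. D division_of \<Union>D \<Longrightarrow> \<Union>D \<subseteq> S \<Longrightarrow> (\<Sum>K\<in>D. Sup K - Inf K) < d2 \<Longrightarrow>
      (\<Sum>K\<in>D. \<bar>g (Sup K) - g (Inf K)\<bar>) < \<epsilon> / 2"
    using g e unfolding absolutely_continuous_on_def by meson
  show "\<exists>\<delta>>0. \<forall>D. D division_of \<Union> D \<and> \<Union> D \<subseteq> S \<and> (\<Sum>K\<in>D. Sup K - Inf K) < \<delta> \<longrightarrow>
      (\<Sum>K\<in>D. \<bar>f (Sup K) + g (Sup K) - (f (Inf K) + g (Inf K))\<bar>) < \<epsilon>"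
  proof (intro exI[of _ "min d1 d2"] conjI allI impI; (elim conjE)?)
    show "min d1 d2 > 0" using d1 d2 by simp
    fix D :: "real set set"
    assume D: "D division_of \<Union> D" "\<Union> D \<subseteq> S" "(\<Sum>K\<in>D. Sup K - Inf K) < min d1 d2"
    have "(\<Sum>K\<in>D. \<bar>f (Sup K) + g (Sup K) - (f (Inf K) + g (Inf K))\<bar>)
        \<le> (\<Sum>K\<in>D. \<bar>f (Sup K) - f (Inf K)\<bar> + \<bar>g (Sup K) - g (Inf K)\<bar>)"
      by (rule sum_mono) linarith
    also have "\<dots> < \<epsilon>"
      using d1(2)[of D] d2(2)[of D] D by (simp add: sum.distrib)
    finally show "(\<Sum>K\<in>D. \<bar>f (Sup K) + g (Sup K) - (f (Inf K) + g (Inf K))\<bar>) < \<epsilon>" .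
  qed
qed

lemma absolutely_continuous_on_imp_continuous_on:
  assumes "absolutely_continuous_on {a..b} f"
  shows "continuous_on {a..b} f"
  unfolding continuous_on_iff
proof (intro ballI allI impI)
  fix x e :: real assume x: "x \<in> {a..b}" and "e > 0"
  then obtain d where d: "d > 0" "\<And>D. D division_of \<Union>D \<Longrightarrow> \<Union>D \<subseteq> {a..b} \<Longrightarrow> (\<Sum>K\<in>D. Sup K - Inf K) < d \<Longrightarrow>
      (\<Sum>K\<in>D. \<bar>f (Sup K) - f (Inf K)\<bar>) < e"
    using assms unfolding absolutely_continuous_on_def by meson
  have *: "\<bar>f v - f u\<bar> < e" if "u \<le> v" "u \<in> {a..b}" "v \<in> {a..b}" "v - u < d" for u v
    using d(2)[of "{{u..v}}"] that division_of_self[of u v] by (auto simp: box_real)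
  show "\<exists>d>0. \<forall>x'\<in>{a..b}. dist x' x < d \<longrightarrow> dist (f x') (f x) < e"
  proof (intro exI[of _ d] conjI ballI impI)
    fix y assume "y \<in> {a..b}" "dist y x < d"
    then show "dist (f y) (f x) < e"
      using *[of x y] *[of y x] x by (cases "x \<le> y") (auto simp: dist_real_def)
  qed (fact d(1))
qed

text \<open>
  The fundamental theorem of calculus for absolutely continuous functions. As in the everywhere
  differentiable case, intervals tagged outside the exceptional set \<open>N\<close> are short enough for the derivative to approximate the increment of
  \<open>f\<close>. Those tagged in \<open>N\<close> are confined by the gauge to an open set of
  small measure, so that absolute continuity makes the sum of their increments small; setting the
  integrand to \<open>0\<close> on \<open>N\<close> removes their other contribution.
\<close>
lemma has_integral_derivative_absolutely_continuous:
  fixes f :: "real \<Rightarrow> real"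
  assumes "a \<le> b" and ac: "absolutely_continuous_on {a..b} f"
    and N: "negligible N"
    and der: "\<And>x. x \<in> {a..b} - N \<Longrightarrow> (f has_real_derivative f' x) (at x within {a..b})"
  shows "(f' has_integral (f b - f a)) {a..b}"
proof -
  define g where "g x = (if x \<in> N then 0 else f' x)" for x
  have "(g has_integral (f b - f a)) (cbox a b)"
    unfolding has_integral
  proof (intro allI impI)
    fix e :: real assume "e > 0"
    define e1 where "e1 = e / (2 * (b - a + 1))"
    have e1: "e1 > 0" "e1 * (b - a) \<le> e / 2"
      using \<open>e > 0\<close> \<open>a \<le> b\<close> by (simp_all add: e1_def field_simps)
    obtain \<delta> where \<delta>: "\<delta> > 0" "\<And>D. D division_of \<Union>D \<Longrightarrow> \<Union>D \<subseteq> {a..b} \<Longrightarrow> (\<Sum>K\<in>D. Sup K - Inf K) < \<delta> \<Longrightarrow>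
      (\<Sum>K\<in>D. \<bar>f (Sup K) - f (Inf K)\<bar>) < e / 2"
      using ac \<open>e > 0\<close> unfolding absolutely_continuous_on_def by (meson half_gt_zero)
    obtain U where U: "open U" "N \<subseteq> U" "U \<in> lmeasurable" "measure lebesgue U < \<delta>"
    proof -
      have "N \<in> null_sets lebesgue" using N by (simp add: negligible_iff_null_sets)
      then obtain U where U: "open U" "N \<subseteq> U" "emeasure lebesgue (U - N) < ennreal \<delta>"
        using sets_lebesgue_outer_open[of N \<delta>] \<delta>(1) by (metis null_setsD2)
      have "emeasure lebesgue (U - N) = emeasure lebesgue U"
        using \<open>N \<in> null_sets lebesgue\<close> U(1) by (intro emeasure_Diff_null_set) auto
      then have lt: "emeasure lebesgue U < ennreal \<delta>" using U(3) by simp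
      then have "U \<in> lmeasurable"
        using U(1) by (intro fmeasurableI) (auto intro: order_less_trans)
      moreover have "measure lebesgue U < \<delta>"
        using lt \<delta>(1) \<open>U \<in> lmeasurable\<close> by (simp add: emeasure_eq_measure2 ennreal_less_iff)
      ultimately show ?thesis using that U by blast
    qed
    have "\<exists>d>0. x \<in> {a..b} - N \<longrightarrow>
         (\<forall>y\<in>{a..b}. \<bar>y - x\<bar> < d \<longrightarrow> \<bar>f y - f x - (y - x) * f' x\<bar> \<le> e1 * \<bar>y - x\<bar>)" for x
    proof (cases "x \<in> {a..b} - N")
      case True
      have "(f has_derivative (*) (f' x)) (at x within {a..b})"
        using der[OF True] by (simp add: has_field_derivative_def)
      then show ?thesis
        using e1(1) unfolding has_derivative_within_alt by (simp add: mult.commute) meson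
    qed (auto intro: exI[of _ 1])
    then obtain d where d: "\<And>x. d x > 0" "\<And>x y. x \<in> {a..b} - N \<Longrightarrow> y \<in> {a..b} \<Longrightarrow> \<bar>y - x\<bar> < d x \<Longrightarrow>
        \<bar>f y - f x - (y - x) * f' x\<bar> \<le> e1 * \<bar>y - x\<bar>"
      by metis
    define \<gamma> where "\<gamma> x = (if x \<in> N then U else ball x (d x))" for x
    have "gauge \<gamma>" using U(1,2) d(1) by (auto simp: gauge_def \<gamma>_def)
    moreover have "norm ((\<Sum>(x, K)\<in>p. measure lborel K *\<^sub>R g x) - (f b - f a)) < e"
      if p: "p tagged_division_of cbox a b" and fine: "\<gamma> fine p" for p
    proof -
      have finp: "finite p" using p by blast
      have len: "b - a = (\<Sum>(x,K)\<in>p. Sup K - Inf K)" and fba: "f b - f a = (\<Sum>(x,K)\<in>p. f (Sup K) - f (Inf K))"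
        using additive_tagged_division_1[OF \<open>a \<le> b\<close>, of p "\<lambda>x. x"]
          additive_tagged_division_1[OF \<open>a \<le> b\<close>, of p f] p by (auto simp: box_real)
      have interval: "\<exists>u v. K = {u..v} \<and> u \<le> v \<and> Inf K = u \<and> Sup K = v \<and> x \<in> K \<and> u \<in> K \<and> v \<in> K
          \<and> K \<subseteq> {a..b} \<and> measure lborel K = v - u \<and> measure lebesgue K = v - u"
        if "(x, K) \<in> p" for x K
      proof -
        obtain u v where "K = cbox u v" "x \<in> K" "K \<subseteq> cbox a b"
          using p \<open>(x, K) \<in> p\<close> by (meson tagged_division_ofD(2,3,4))
        then show ?thesis by (intro exI[of _ u] exI[of _ v]) (auto simp: box_real)
      qed
      have fine_le: "K \<subseteq> \<gamma> x" if "(x, K) \<in> p" for x K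
        using fine that unfolding fine_def by blast
      define A where "A = {z \<in> p. fst z \<in> N}"
      have "A \<subseteq> p" by (auto simp: A_def)
      have "finite A" using \<open>A \<subseteq> p\<close> finp finite_subset by blast
      let ?t = "\<lambda>(x,K). measure lborel K * g x - (f (Sup K) - f (Inf K))"
      have "\<bar>\<Sum>z\<in>p - A. ?t z\<bar> \<le> (\<Sum>(x,K)\<in>p - A. e1 * (Sup K - Inf K))"
      proof (rule order_trans[OF sum_abs], rule sum_mono)
        fix z assume z: "z \<in> p - A"
        obtain x K where xK: "z = (x, K)" by (cases z)
        then have "x \<notin> N" "(x, K) \<in> p" using z by (auto simp: A_def)
        obtain u v where uv: "K = {u..v}" "u \<le> v" "Inf K = u" "Sup K = v" "x \<in> K" "u \<in> K" "v \<in> K"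
            "K \<subseteq> {a..b}" "measure lborel K = v - u"
          using interval[OF \<open>(x, K) \<in> p\<close>] by blast
        have "K \<subseteq> ball x (d x)"
          using fine_le[OF \<open>(x, K) \<in> p\<close>] \<open>x \<notin> N\<close> by (simp add: \<gamma>_def)
        then have "\<bar>u - x\<bar> < d x" "\<bar>v - x\<bar> < d x"
          using subsetD[of K "ball x (d x)" u] subsetD[of K "ball x (d x)" v] uv(6,7)
          by (simp_all add: dist_real_def abs_minus_commute)
        moreover have "x \<in> {a..b} - N" "u \<in> {a..b}" "v \<in> {a..b}" using uv \<open>x \<notin> N\<close> by blast+
        moreover have "\<bar>u - x\<bar> = x - u" "\<bar>v - x\<bar> = v - x" using uv by auto
        ultimately have "\<bar>f u - f x - (u - x) * f' x\<bar> \<le> e1 * (x - u)" "\<bar>f v - f x - (v - x) * f' x\<bar> \<le> e1 * (v - x)"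
          using d(2)[of x u] d(2)[of x v] by simp_all
        moreover have "(v - u) * f' x - (f v - f u) = (f u - f x - (u - x) * f' x) - (f v - f x - (v - x) * f' x)"
          by (simp add: algebra_simps)
        moreover have "e1 * (x - u) + e1 * (v - x) = e1 * (v - u)" by (simp add: algebra_simps)
        ultimately have "\<bar>(v - u) * f' x - (f v - f u)\<bar> \<le> e1 * (v - u)" by linarith
        then show "\<bar>?t z\<bar> \<le> (case z of (x, K) \<Rightarrow> e1 * (Sup K - Inf K))"
          using uv \<open>x \<notin> N\<close> by (simp add: xK g_def)
      qed
      also have "\<dots> \<le> (\<Sum>(x,K)\<in>p. e1 * (Sup K - Inf K))"
      proof (rule sum_mono2[OF finp])
        show "0 \<le> (case z of (x, K) \<Rightarrow> e1 * (Sup K - Inf K))" if "z \<in> p - (p - A)" for z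
          using that interval[of "fst z" "snd z"] e1(1) by (force simp: case_prod_beta)
      qed auto
      also have "\<dots> = e1 * (b - a)" by (simp add: len sum_distrib_left case_prod_beta)
      finally have out: "\<bar>\<Sum>z\<in>p - A. ?t z\<bar> \<le> e / 2" using e1(2) by linarith
      \<comment> \<open>A non-empty interval with empty interior is a point, so even degenerate intervals determine
        their tag, and the sum over tagged intervals is a sum over a division.\<close>
      have inj: "inj_on snd A"
      proof (rule inj_onI)
        fix z w assume z: "z \<in> A" and w: "w \<in> A" and eq: "snd z = snd w"
        obtain x K y where xy: "z = (x, K)" "w = (y, K)" using eq by (cases z; cases w) auto
        have mem: "(x, K) \<in> p" "(y, K) \<in> p" using z w xy by (auto simp: A_def)
        show "z = w"
        proof (rule ccontr)
          assume "z \<noteq> w"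
          then have "interior K \<inter> interior K = {}"
            using tagged_division_ofD(5)[OF p mem(1) mem(2)] xy by blast
          then have "interior K = {}" by simp
          moreover obtain u v where uv: "K = {u..v}" "u \<le> v" "x \<in> K" using interval[OF mem(1)] by blast
          moreover have "y \<in> K" using interval[OF mem(2)] by blast
          ultimately have "x = y" by (auto simp: interior_atLeastAtMost_real)
          then show False using \<open>z \<noteq> w\<close> xy by simp
        qed
      qed
      have div: "snd ` A division_of \<Union>(snd ` A)"
        using p \<open>A \<subseteq> p\<close> unfolding tagged_division_of_def
        by (blast intro: partial_division_of_tagged_division tagged_partial_division_subset)
      have "(\<Sum>K\<in>snd ` A. Sup K - Inf K) = (\<Sum>K\<in>snd ` A. measure lebesgue K)"
        using interval by (intro sum.cong) (force simp: A_def)+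
      also have "\<dots> = measure lebesgue (\<Union>(snd ` A))"
        by (rule content_division[OF div])
      also have "\<dots> \<le> measure lebesgue U"
      proof (rule measure_mono_fmeasurable)
        show "\<Union>(snd ` A) \<subseteq> U" 
        proof (rule Union_least)
          fix K assume "K \<in> snd ` A"
          then obtain x where "(x, K) \<in> p" "x \<in> N" by (auto simp: A_def)
          then show "K \<subseteq> U" using fine_le by (force simp: \<gamma>_def)
        qed
        show "\<Union>(snd ` A) \<in> sets lebesgue" 
          using lmeasurable_division[OF div] by (rule fmeasurableD)
      qed (fact U(3))
      also have "\<dots> < \<delta>" by (fact U(4))
      finally have "(\<Sum>K\<in>snd ` A. \<bar>f (Sup K) - f (Inf K)\<bar>) < e / 2"
        using interval by (intro \<delta>(2)[OF div]) (force simp: A_def)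
      moreover have "\<bar>\<Sum>z\<in>A. ?t z\<bar> \<le> (\<Sum>z\<in>A. \<bar>f (Sup (snd z)) - f (Inf (snd z))\<bar>)"
        by (rule order_trans[OF sum_abs], rule sum_mono) (auto simp: A_def g_def)
      ultimately have inn: "\<bar>\<Sum>z\<in>A. ?t z\<bar> < e / 2"
        by (simp add: sum.reindex[OF inj])
      have "(\<Sum>(x, K)\<in>p. measure lborel K *\<^sub>R g x) - (f b - f a) = (\<Sum>z\<in>p. ?t z)"
        by (simp add: fba sum_subtractf case_prod_beta)
      also have "\<dots> = (\<Sum>z\<in>p - A. ?t z) + (\<Sum>z\<in>A. ?t z)"
        using sum.subset_diff[OF \<open>A \<subseteq> p\<close> finp] .
      finally show ?thesis using out inn by simp
    qed
    ultimately show "\<exists>\<gamma>. gauge \<gamma> \<and> (\<forall>p. p tagged_division_of cbox a b \<and> \<gamma> fine p \<longrightarrow>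
        norm ((\<Sum>(x, K)\<in>p. measure lborel K *\<^sub>R g x) - (f b - f a)) < e)"
      by (intro exI[of _ \<gamma>]) simp
  qed
  then have "(g has_integral (f b - f a)) {a..b}" by (simp add: box_real)
  then show ?thesis
    by (rule has_integral_spike[OF N, rotated]) (simp add: g_def)
qed

section \<open>Variations of the angle\<close>

text \<open>
  A variation is recorded together with a bounded representative \<open>\<psi>\<close> of its
  derivative: \<open>\<psi>\<close> is what is added to the control when \<open>\<phi>\<close> is
  added to the angle. Lipschitz functions rather than smooth ones are used so that the piecewise
  linear functions \<open>green T s\<close> below qualify.
\<close>
definition variation :: "real \<Rightarrow> (real \<Rightarrow> real) \<Rightarrow> (real \<Rightarrow> real) \<Rightarrow> bool" where
  "variation T \<phi> \<psi> \<longleftrightarrow>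
    \<phi> 0 = 0 \<and> \<phi> T = 0 \<and>
    (\<exists>L. L-lipschitz_on {0..T} \<phi>) \<and>
    \<psi> \<in> borel_measurable (lebesgue_on {0..T}) \<and>
    (\<exists>B. \<forall>t\<in>{0..T}. \<bar>\<psi> t\<bar> \<le> B) \<and>
    (AE t in lebesgue_on {0..T}. (\<phi> has_real_derivative \<psi> t) (at t within {0..T}))"

lemma variation_continuous_on:
  "variation T \<phi> \<psi> \<Longrightarrow> continuous_on {0..T} \<phi>"
  unfolding variation_def using lipschitz_on_continuous_on by blast

lemma variation_bounds:
  assumes "variation T \<phi> \<psi>"
  obtains B where "B \<ge> 0" "\<And>t. t \<in> {0..T} \<Longrightarrow> \<bar>\<phi> t\<bar> \<le> B" "\<And>t. t \<in> {0..T} \<Longrightarrow> \<bar>\<psi> t\<bar> \<le> B"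
proof -
  obtain B1 where B1: "\<And>t. t \<in> {0..T} \<Longrightarrow> norm (\<phi> t) \<le> B1"
    using continuous_on_compact_bound[OF compact_Icc variation_continuous_on[OF assms]] by blast
  obtain B2 where B2: "\<And>t. t \<in> {0..T} \<Longrightarrow> \<bar>\<psi> t\<bar> \<le> B2"
    using assms unfolding variation_def by blast
  show thesis
    using that[of "max 0 (max B1 B2)"] B1 B2 by (simp add: le_max_iff_disj)
qed

lemma variation_scale:
  assumes "variation T \<phi> \<psi>"
  shows "variation T (\<lambda>t. c * \<phi> t) (\<lambda>t. c * \<psi> t)"
proof -
  obtain L B where L: "L-lipschitz_on {0..T} \<phi>" and B: "\<forall>t\<in>{0..T}. \<bar>\<psi> t\<bar> \<le> B"
    using assms by (auto simp: variation_def)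
  have "(\<bar>c\<bar> * L)-lipschitz_on {0..T} (\<lambda>t. c * \<phi> t)"
    using lipschitz_on_cmult[OF L, of c] by simp
  moreover have "\<forall>t\<in>{0..T}. \<bar>c * \<psi> t\<bar> \<le> \<bar>c\<bar> * B"
    using B by (simp add: abs_mult mult_left_mono)
  moreover have "AE t in lebesgue_on {0..T}.
      ((\<lambda>t. c * \<phi> t) has_real_derivative c * \<psi> t) (at t within {0..T})"
  proof -
    have "AE t in lebesgue_on {0..T}. (\<phi> has_real_derivative \<psi> t) (at t within {0..T})"
      using assms by (simp add: variation_def)
    then show ?thesis by eventually_elim (rule DERIV_cmult)
  qed
  ultimately show ?thesis
    using assms unfolding variation_def by auto
qed

lemma variation_add:
  assumes "variation T \<phi> \<psi>" "variation T \<phi>' \<psi>'"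
  shows "variation T (\<lambda>t. \<phi> t + \<phi>' t) (\<lambda>t. \<psi> t + \<psi>' t)"
proof -
  obtain L B L' B' where L: "L-lipschitz_on {0..T} \<phi>" "L'-lipschitz_on {0..T} \<phi>'"
    and B: "\<forall>t\<in>{0..T}. \<bar>\<psi> t\<bar> \<le> B" "\<forall>t\<in>{0..T}. \<bar>\<psi>' t\<bar> \<le> B'"
    using assms by (auto simp: variation_def)
  have "(L + L')-lipschitz_on {0..T} (\<lambda>t. \<phi> t + \<phi>' t)"
    using L by (rule lipschitz_on_add)
  moreover have "\<forall>t\<in>{0..T}. \<bar>\<psi> t + \<psi>' t\<bar> \<le> B + B'"
    using B by (meson abs_triangle_ineq add_mono order_trans)
  moreover have "AE t in lebesgue_on {0..T}.
      ((\<lambda>t. \<phi> t + \<phi>' t) has_real_derivative \<psi> t + \<psi>' t) (at t within {0..T})"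
  proof -
    have "AE t in lebesgue_on {0..T}. (\<phi> has_real_derivative \<psi> t) (at t within {0..T})"
      "AE t in lebesgue_on {0..T}. (\<phi>' has_real_derivative \<psi>' t) (at t within {0..T})"
      using assms by (auto simp: variation_def)
    then show ?thesis by eventually_elim (rule DERIV_add)
  qed
  ultimately show ?thesis
    using assms unfolding variation_def by auto
qed

text \<open>
  The Green function of \<open>- d^2/dt^2\<close> on the interval from \<open>0\<close> to
  \<open>T\<close> with Dirichlet boundary conditions. Its \<open>t\<close>-derivative is the indicator
  of \<open>t < s\<close> minus its mean, so integrating a control against that derivative evaluates
  the angle at \<open>s\<close> up to an affine function of \<open>s\<close>.
\<close>
definition green :: "real \<Rightarrow> real \<Rightarrow> real \<Rightarrow> real" where
  "green T s t = min s t - s * t / T"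

lemma green_commute: "green T s t = green T t s"
  by (simp add: green_def min.commute mult.commute)

lemma green_lipschitz:
  assumes "T > 0" "s \<in> {0..T}"
  shows "\<bar>green T s t - green T s r\<bar> \<le> 2 * \<bar>t - r\<bar>"
proof -
  have "\<bar>s / T\<bar> \<le> 1" using assms by simp
  then have "\<bar>(s / T) * (t - r)\<bar> \<le> 1 * \<bar>t - r\<bar>" unfolding abs_mult by (intro mult_right_mono) auto
  moreover have eq: "s * t / T - s * r / T = (s / T) * (t - r)"
    by (simp add: right_diff_distrib)
  ultimately have "\<bar>s * t / T - s * r / T\<bar> \<le> \<bar>t - r\<bar>" by (simp only: eq mult_1)
  moreover have "\<bar>min s t - min s r\<bar> \<le> \<bar>t - r\<bar>" by (simp add: min_def)
  moreover have "\<bar>m - p - (n - q)\<bar> \<le> 2 * e" if "\<bar>p - q\<bar> \<le> e" "\<bar>m - n\<bar> \<le> e" for m n p q e :: real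
    using that by linarith
  ultimately show ?thesis
    unfolding green_def by blast
qed

lemma variation_green:
  assumes "T > 0" "s \<in> {0..T}"
  shows "variation T (green T s) (\<lambda>t. (if t < s then 1 else 0) - s / T)"
proof -
  have "2-lipschitz_on {0..T} (green T s)"
    using green_lipschitz[OF assms] by (intro lipschitz_onI) (auto simp: dist_real_def)
  moreover have "AE t in lebesgue_on {0..T}.
    (green T s has_real_derivative (if t < s then 1 else 0) - s / T) (at t within {0..T})"
  proof -
    have der: "(green T s has_real_derivative (if t < s then 1 else 0) - s / T) (at t within {0..T})"
      if "t \<noteq> s" for t
    proof -
      have "(green T s has_real_derivative (if t < s then 1 else 0) - s / T) (at t)"
      proof (cases "t < s")
        case True
        have "((\<lambda>t. t - s * t / T) has_real_derivative 1 - s / T) (at t)"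
          using assms by (auto intro!: derivative_eq_intros)
        then show ?thesis
          by (rule DERIV_cong_ev[THEN iffD1, rotated -1])
            (use True eventually_nhds_in_open[of "{..<s}" t] in \<open>auto simp: green_def elim!: eventually_mono\<close>)
      next
        case False
        have "((\<lambda>t. s - s * t / T) has_real_derivative - (s / T)) (at t)"
          using assms by (auto intro!: derivative_eq_intros)
        then show ?thesis
          by (rule DERIV_cong_ev[THEN iffD1, rotated -1])
            (use False that eventually_nhds_in_open[of "{s<..}" t] in \<open>auto simp: green_def elim!: eventually_mono\<close>)
      qed
      then show ?thesis by (rule has_field_derivative_at_within)
    qed
    show ?thesis
      by (subst AE_lebesgue_on_iff_negligible, simp, rule negligible_subset[of "{s}"]) (use der in \<open>simp, blast\<close>)
  qed
  moreover have "\<exists>B. \<forall>t\<in>{0..T}. \<bar>(if t < s then 1 else 0) - s / T\<bar> \<le> B"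
    using assms by (intro exI[of _ 1]) (auto simp: field_simps)
  moreover have "(\<lambda>t. (if t < s then 1 else 0) - s / T) \<in> borel_measurable (lebesgue_on {0..T})"
    by (intro measurable_restrict_space1 measurable_completion) measurable
  ultimately show ?thesis
    using assms unfolding variation_def by (simp add: green_def) blast
qed

lemma continuous_on_green: "continuous_on S (green T s)"
  unfolding green_def by (cases "T = 0") (auto intro!: continuous_intros)

text \<open>
  If \<open>h t0 > 0\<close>, then \<open>h\<close> is positive on a neighbourhood of
  \<open>t0\<close>. The negated second difference of the Green functions at
  \<open>t0 - r\<close>, \<open>t0\<close>, \<open>t0 + r\<close> is the hat function of height
  \<open>r\<close> supported there, and its integral against \<open>h\<close> would be positive.
\<close>
lemma orthogonal_green_imp_nonpos:
  fixes h :: "real \<Rightarrow> real"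
  assumes "T > 0" and h: "continuous_on {0..T} h"
    and orth: "\<And>s. s \<in> {0..T} \<Longrightarrow> integral {0..T} (\<lambda>t. h t * green T s t) = 0"
    and t0: "t0 \<in> {0<..<T}"
  shows "h t0 \<le> 0"
proof (rule ccontr)
  assume "\<not> h t0 \<le> 0"
  then have pos: "h t0 > 0" by simp
  have "t0 \<in> {0..T}" using t0 by auto
  then obtain d where d: "d > 0" "\<And>t. t \<in> {0..T} \<Longrightarrow> dist t t0 < d \<Longrightarrow> dist (h t) (h t0) < h t0"
    using h pos unfolding continuous_on_iff by blast
  define r where "r = min (d / 2) (min t0 (T - t0))"
  have r: "r > 0" "r < d" "t0 - r \<ge> 0" "t0 + r \<le> T" using d(1) t0 by (auto simp: r_def)
  define \<eta> where "\<eta> t = - (green T (t0 - r) t - 2 * green T t0 t + green T (t0 + r) t)" for t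
  have \<eta>: "\<eta> t = max 0 (r - \<bar>t - t0\<bar>)" for t
  proof -
    have "\<eta> t = 2 * min t0 t - min (t0 - r) t - min (t0 + r) t"
      using \<open>T > 0\<close> by (simp add: \<eta>_def green_def field_simps)
    then show ?thesis using r(1) by (auto simp: min_def max_def)
  qed
  have int: "(\<lambda>t. h t * green T s t) integrable_on {0..T}" for s
    by (intro integrable_continuous_interval continuous_intros h continuous_on_green)
  have "integral {0..T} (\<lambda>t. h t * \<eta> t)
      = integral {0..T} (\<lambda>t. 2 * (h t * green T t0 t) - h t * green T (t0 - r) t - h t * green T (t0 + r) t)"
    by (simp add: \<eta>_def algebra_simps)
  also have "\<dots> = 0"
    using r t0 orth int by (simp add: integral_diff integrable_diff)
  finally have "integral {0..T} (\<lambda>t. h t * \<eta> t) = 0" .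
  moreover have "continuous_on {0..T} (\<lambda>t. h t * \<eta> t)"
    unfolding \<eta> by (intro continuous_intros h)
  moreover have "h t * \<eta> t \<ge> 0" if "t \<in> {0..T}" for t
  proof (cases "\<bar>t - t0\<bar> < r")
    case True
    then have "h t > 0" using d(2)[OF that] r by (auto simp: dist_real_def)
    then show ?thesis by (simp add: \<eta>)
  qed (simp add: \<eta>)
  ultimately have "h t0 * \<eta> t0 = 0"
    using integral_eq_0_iff[of 0 T "\<lambda>t. h t * \<eta> t"] \<open>T > 0\<close> \<open>t0 \<in> {0..T}\<close> by auto
  then show False using pos r by (simp add: \<eta>)
qed

lemma orthogonal_green_imp_zero:
  fixes h :: "real \<Rightarrow> real"
  assumes "T > 0" and h: "continuous_on {0..T} h"
    and orth: "\<And>s. s \<in> {0..T} \<Longrightarrow> integral {0..T} (\<lambda>t. h t * green T s t) = 0"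
    and t0: "t0 \<in> {0<..<T}"
  shows "h t0 = 0"
  using orthogonal_green_imp_nonpos[OF assms] orthogonal_green_imp_nonpos[of T "\<lambda>t. - h t" t0] assms
  by (force intro: continuous_intros)

text \<open>
  The open mapping theorem used for \<open>energy_decreasing_perturbation\<close> asks for
  differentiability at one point, where it follows from a quadratic bound on the remainder.
\<close>
lemma quadratic_remainder_has_derivative:
  fixes f :: "'a::real_normed_vector \<Rightarrow> 'b::real_normed_vector"
  assumes "bounded_linear f'" and rem: "\<And>c. norm (f c - f 0 - f' c) \<le> K * (norm c)\<^sup>2"
  shows "(f has_derivative f') (at 0)"
  unfolding has_derivative_at_alt
proof (intro conjI allI impI assms(1))
  fix e :: real assume "e > 0"
  show "\<exists>d>0. \<forall>y. norm (y - 0) < d \<longrightarrow> norm (f y - f 0 - f' (y - 0)) \<le> e * norm (y - 0)"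
  proof (intro exI[of _ "e / (\<bar>K\<bar> + 1)"] conjI allI impI)
    show "e / (\<bar>K\<bar> + 1) > 0" using \<open>e > 0\<close> by simp
    fix y :: 'a assume "norm (y - 0) < e / (\<bar>K\<bar> + 1)"
    then have "(\<bar>K\<bar> + 1) * norm y \<le> e" by (simp add: field_simps)
    moreover have "K * norm y \<le> (\<bar>K\<bar> + 1) * norm y" by (intro mult_right_mono) auto
    ultimately have "K * norm y * norm y \<le> e * norm y" by (intro mult_right_mono) auto
    then show "norm (f y - f 0 - f' (y - 0)) \<le> e * norm (y - 0)"
      using rem[of y] by (simp add: power2_eq_square mult.assoc)
  qed
qed

lemma lipschitz_derivative_taylor:
  fixes F F' :: "real \<Rightarrow> real"
  assumes "\<And>x. (F has_real_derivative F' x) (at x)" and "\<And>x y. \<bar>F' x - F' y\<bar> \<le> \<bar>x - y\<bar>"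
  shows "\<bar>F (x + h) - F x - F' x * h\<bar> \<le> h\<^sup>2"
proof -
  have *: "\<exists>z. \<bar>z - x\<bar> \<le> \<bar>h\<bar> \<and> F (x + h) - F x = h * F' z"
  proof (cases h "0::real" rule: linorder_cases)
    case less
    then obtain z where "x + h < z" "z < x" "F x - F (x + h) = (x - (x + h)) * F' z"
      using MVT2[of "x + h" x F F'] assms(1) by auto
    then show ?thesis using less by (intro exI[of _ z]) (auto simp: algebra_simps)
  next
    case greater
    then obtain z where "x < z" "z < x + h" "F (x + h) - F x = (x + h - x) * F' z"
      using MVT2[of x "x + h" F F'] assms(1) by auto
    then show ?thesis using greater by (intro exI[of _ z]) auto
  qed auto
  then obtain z where z: "\<bar>z - x\<bar> \<le> \<bar>h\<bar>" "F (x + h) - F x = h * F' z" by blast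
  have "\<bar>F (x + h) - F x - F' x * h\<bar> = \<bar>h\<bar> * \<bar>F' z - F' x\<bar>"
    unfolding z(2) by (simp add: abs_mult[symmetric] algebra_simps)
  also have "\<dots> \<le> \<bar>h\<bar> * \<bar>h\<bar>"
    using assms(2)[of z x] z(1) by (intro mult_left_mono) auto
  finally show ?thesis by (simp add: power2_eq_square)
qed

text \<open>
  The first variation of an endpoint coordinate, where \<open>F\<close> is the cosine or the sine:
  the Taylor remainder is at most the square of the perturbation, uniformly in \<open>t\<close>.
\<close>
lemma perturbed_integral_has_derivative:
  fixes \<Phi> :: "'a::euclidean_space \<Rightarrow> real \<Rightarrow> real" and F F' \<theta> :: "real \<Rightarrow> real"
  assumes "T \<ge> 0" and \<theta>: "continuous_on {0..T} \<theta>"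
    and F: "\<And>x. (F has_real_derivative F' x) (at x)" and F': "\<And>x y. \<bar>F' x - F' y\<bar> \<le> \<bar>x - y\<bar>"
    and lin: "\<And>t. linear (\<lambda>c. \<Phi> c t)"
    and bd: "\<And>c t. t \<in> {0..T} \<Longrightarrow> \<bar>\<Phi> c t\<bar> \<le> B * norm c"
    and cont: "\<And>c. continuous_on {0..T} (\<Phi> c)"
  shows "((\<lambda>c. integral {0..T} (\<lambda>t. F (\<theta> t + \<Phi> c t) - F (\<theta> t))) has_derivative
      (\<lambda>c. integral {0..T} (\<lambda>t. F' (\<theta> t) * \<Phi> c t))) (at 0)"
proof (rule quadratic_remainder_has_derivative)
  have contF: "continuous_on S F" for S
    using F by (meson DERIV_isCont continuous_at_imp_continuous_on)
  have contF': "continuous_on S F'" for S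
    using F' by (intro lipschitz_on_continuous_on[of 1] lipschitz_onI) (auto simp: dist_real_def)
  have i1: "(\<lambda>t. F' (\<theta> t) * \<Phi> c t) integrable_on {0..T}" for c
    by (intro integrable_continuous_interval continuous_intros cont
        continuous_on_compose2[OF contF' \<theta>]) auto
  have i2: "(\<lambda>t. F (\<theta> t + \<Phi> c t) - F (\<theta> t)) integrable_on {0..T}" for c
    by (intro integrable_continuous_interval continuous_intros cont \<theta>
        continuous_on_compose2[OF contF]) auto
  have "linear (\<lambda>c. integral {0..T} (\<lambda>t. F' (\<theta> t) * \<Phi> c t))"
  proof (rule linearI)
    fix c d r
    have "integral {0..T} (\<lambda>t. F' (\<theta> t) * \<Phi> (c + d) t)
        = integral {0..T} (\<lambda>t. F' (\<theta> t) * \<Phi> c t + F' (\<theta> t) * \<Phi> d t)"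
      using linear_add[OF lin] by (simp add: algebra_simps)
    then show "integral {0..T} (\<lambda>t. F' (\<theta> t) * \<Phi> (c + d) t)
        = integral {0..T} (\<lambda>t. F' (\<theta> t) * \<Phi> c t) + integral {0..T} (\<lambda>t. F' (\<theta> t) * \<Phi> d t)"
      by (simp add: integral_add i1)
    have "integral {0..T} (\<lambda>t. F' (\<theta> t) * \<Phi> (r *\<^sub>R c) t)
        = integral {0..T} (\<lambda>t. r * (F' (\<theta> t) * \<Phi> c t))"
      using linear_cmul[OF lin] by (simp add: algebra_simps)
    then show "integral {0..T} (\<lambda>t. F' (\<theta> t) * \<Phi> (r *\<^sub>R c) t)
        = r *\<^sub>R integral {0..T} (\<lambda>t. F' (\<theta> t) * \<Phi> c t)"
      by simp
  qed
  then show "bounded_linear (\<lambda>c. integral {0..T} (\<lambda>t. F' (\<theta> t) * \<Phi> c t))"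
    by (simp add: linear_conv_bounded_linear)
  fix c
  have "norm (integral {0..T} (\<lambda>t. F (\<theta> t + \<Phi> c t) - F (\<theta> t) - F' (\<theta> t) * \<Phi> c t))
      \<le> (B * norm c)\<^sup>2 * (T - 0)"
  proof (rule integral_bound)
    show "continuous_on {0..T} (\<lambda>t. F (\<theta> t + \<Phi> c t) - F (\<theta> t) - F' (\<theta> t) * \<Phi> c t)"
      by (intro continuous_intros cont \<theta> continuous_on_compose2[OF contF]
          continuous_on_compose2[OF contF' \<theta>]) auto
    fix t assume t: "t \<in> {0..T}"
    have "\<bar>F (\<theta> t + \<Phi> c t) - F (\<theta> t) - F' (\<theta> t) * \<Phi> c t\<bar> \<le> (\<Phi> c t)\<^sup>2"
      by (rule lipschitz_derivative_taylor[OF F F'])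
    also have "\<dots> \<le> (B * norm c)\<^sup>2" using bd[OF t, of c] by (rule power2_le_iff_abs_le[THEN iffD2, rotated]) (use bd[OF t, of c] in linarith)
    finally show "norm (F (\<theta> t + \<Phi> c t) - F (\<theta> t) - F' (\<theta> t) * \<Phi> c t) \<le> (B * norm c)\<^sup>2" by simp
  qed (fact \<open>T \<ge> 0\<close>)
  moreover have "integral {0..T} (\<lambda>t. F (\<theta> t + \<Phi> c t) - F (\<theta> t) - F' (\<theta> t) * \<Phi> c t)
      = integral {0..T} (\<lambda>t. F (\<theta> t + \<Phi> c t) - F (\<theta> t)) - integral {0..T} (\<lambda>t. F' (\<theta> t) * \<Phi> c t)"
    by (rule integral_diff[OF i2 i1])
  ultimately show "norm (integral {0..T} (\<lambda>t. F (\<theta> t + \<Phi> c t) - F (\<theta> t)) -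
      integral {0..T} (\<lambda>t. F (\<theta> t + \<Phi> 0 t) - F (\<theta> t)) -
      integral {0..T} (\<lambda>t. F' (\<theta> t) * \<Phi> c t)) \<le> B\<^sup>2 * T * (norm c)\<^sup>2"
    using linear_0[OF lin] by (simp add: power_mult_distrib mult.commute mult.left_commute)
qed

section \<open>Perturbed trajectories and their energy\<close>

text \<open>
  A trajectory in coordinates, with a real-valued lift \<open>\<theta>\<close> of the angle.
\<close>
definition lifted_trajectory ::
  "real \<Rightarrow> (real \<Rightarrow> real) \<Rightarrow> (real \<Rightarrow> real) \<Rightarrow> (real \<Rightarrow> real) \<Rightarrow> (real \<Rightarrow> real) \<Rightarrow> bool" where
  "lifted_trajectory T u x y \<theta> \<longleftrightarrow>
    absolutely_continuous_on {0..T} x \<and> absolutely_continuous_on {0..T} y \<and>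
    absolutely_continuous_on {0..T} \<theta> \<and>
    (AE t in lebesgue_on {0..T}.
        (x has_real_derivative cos (\<theta> t)) (at t within {0..T}) \<and>
        (y has_real_derivative sin (\<theta> t)) (at t within {0..T}) \<and>
        (\<theta> has_real_derivative u t) (at t within {0..T}))"

lemma absolutely_continuous_on_integral:
  fixes f :: "real \<Rightarrow> real"
  assumes "continuous_on {0..T} f"
  shows "absolutely_continuous_on {0..T} (\<lambda>t. integral {0..t} f)"
    and "t \<in> {0..T} \<Longrightarrow> ((\<lambda>t. integral {0..t} f) has_real_derivative f t) (at t within {0..T})"
proof -
  show der: "((\<lambda>t. integral {0..t} f) has_real_derivative f t) (at t within {0..T})" if "t \<in> {0..T}" for t
    using integral_has_real_derivative[OF assms that] .
  obtain L where L: "L \<ge> 0" "\<And>t. t \<in> {0..T} \<Longrightarrow> norm (f t) \<le> L"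
    using continuous_on_compact_bound[OF compact_Icc assms] by blast
  have "L-lipschitz_on {0..T} (\<lambda>t. integral {0..t} f)"
  proof (rule bounded_derivative_imp_lipschitz)
    show "((\<lambda>t. integral {0..t} f) has_derivative (*) (f t)) (at t within {0..T})" if "t \<in> {0..T}" for t
      using der[OF that] by (simp add: has_field_derivative_def)
    show "onorm ((*) (f t)) \<le> L" if "t \<in> {0..T}" for t
      using L(2)[OF that] by (intro onorm_le) (simp add: abs_mult mult_right_mono)
  qed (use L(1) in auto)
  then show "absolutely_continuous_on {0..T} (\<lambda>t. integral {0..t} f)"
    by (rule absolutely_continuous_on_lipschitz)
qed

text \<open>
  The planar coordinates are perturbed by the integral of the change of velocity, not recomputed from
  their initial values: the conditions on the new endpoint then say that the integrals of
  the two changes of velocity vanish.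
\<close>
lemma lifted_trajectory_perturb:
  assumes traj: "lifted_trajectory T u x y \<theta>" and var: "variation T \<phi> \<psi>"
  shows "lifted_trajectory T (\<lambda>t. u t + \<psi> t)
      (\<lambda>t. x t + integral {0..t} (\<lambda>r. cos (\<theta> r + \<phi> r) - cos (\<theta> r)))
      (\<lambda>t. y t + integral {0..t} (\<lambda>r. sin (\<theta> r + \<phi> r) - sin (\<theta> r)))
      (\<lambda>t. \<theta> t + \<phi> t)"
proof -
  note ac = traj[unfolded lifted_trajectory_def]
  have \<theta>: "continuous_on {0..T} \<theta>"
    using ac absolutely_continuous_on_imp_continuous_on by blast
  note \<phi> = variation_continuous_on[OF var]
  have c: "continuous_on {0..T} (\<lambda>r. cos (\<theta> r + \<phi> r) - cos (\<theta> r))"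
    "continuous_on {0..T} (\<lambda>r. sin (\<theta> r + \<phi> r) - sin (\<theta> r))"
    by (intro continuous_intros \<theta> \<phi>)+
  have "absolutely_continuous_on {0..T} \<phi>"
    using var absolutely_continuous_on_lipschitz by (auto simp: variation_def)
  then have "absolutely_continuous_on {0..T} (\<lambda>t. \<theta> t + \<phi> t)"
    "absolutely_continuous_on {0..T} (\<lambda>t. x t + integral {0..t} (\<lambda>r. cos (\<theta> r + \<phi> r) - cos (\<theta> r)))"
    "absolutely_continuous_on {0..T} (\<lambda>t. y t + integral {0..t} (\<lambda>r. sin (\<theta> r + \<phi> r) - sin (\<theta> r)))"
    using ac absolutely_continuous_on_integral(1)[OF c(1)] absolutely_continuous_on_integral(1)[OF c(2)]
    by (simp_all add: absolutely_continuous_on_add)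
  moreover have "AE t in lebesgue_on {0..T}.
        ((\<lambda>t. x t + integral {0..t} (\<lambda>r. cos (\<theta> r + \<phi> r) - cos (\<theta> r)))
            has_real_derivative cos (\<theta> t + \<phi> t)) (at t within {0..T}) \<and>
        ((\<lambda>t. y t + integral {0..t} (\<lambda>r. sin (\<theta> r + \<phi> r) - sin (\<theta> r)))
            has_real_derivative sin (\<theta> t + \<phi> t)) (at t within {0..T}) \<and>
        ((\<lambda>t. \<theta> t + \<phi> t) has_real_derivative u t + \<psi> t) (at t within {0..T})"
  proof -
    have 1: "AE t in lebesgue_on {0..T}.
        (x has_real_derivative cos (\<theta> t)) (at t within {0..T}) \<and>
        (y has_real_derivative sin (\<theta> t)) (at t within {0..T}) \<and>
        (\<theta> has_real_derivative u t) (at t within {0..T})" using ac by blast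
    have 2: "AE t in lebesgue_on {0..T}. (\<phi> has_real_derivative \<psi> t) (at t within {0..T})"
      using var by (simp add: variation_def)
    have 3: "AE t in lebesgue_on {0..T}. t \<in> {0..T}"
      by (rule AE_I2) (simp add: space_restrict_space)
    show ?thesis using 1 2 3
    proof eventually_elim
      case (elim t)
      then show ?case
        using DERIV_add[OF _ absolutely_continuous_on_integral(2)[OF c(1)], of x "cos (\<theta> t)" t]
          DERIV_add[OF _ absolutely_continuous_on_integral(2)[OF c(2)], of y "sin (\<theta> t)" t]
        by (simp add: DERIV_add)
    qed
  qed
  ultimately show ?thesis unfolding lifted_trajectory_def by blast
qed

lemma L2_control_times_bounded_integrable:
  assumes "L2_control T u" and "\<psi> \<in> borel_measurable (lebesgue_on {0..T})"
    and B: "\<And>t. t \<in> {0..T} \<Longrightarrow> \<bar>\<psi> t\<bar> \<le> B"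
  shows "integrable (lebesgue_on {0..T}) (\<lambda>t. u t * \<psi> t)"
proof -
  have m: "u \<in> borel_measurable (lebesgue_on {0..T})"
    and i: "integrable (lebesgue_on {0..T}) (\<lambda>t. (u t)\<^sup>2)"
    using assms(1) by (auto simp: L2_control_def)
  have c: "integrable (lebesgue_on {0..T}) (\<lambda>t. c)" for c :: real
    by (rule finite_measure.integrable_const) (simp add: finite_measure_lebesgue_on)
  have "integrable (lebesgue_on {0..T}) (\<lambda>t. (1 + (u t)\<^sup>2) * B)"
    using c i by (intro integrable_mult_left Bochner_Integration.integrable_add) auto
  then show ?thesis
  proof (rule Bochner_Integration.integrable_bound)
    show "(\<lambda>t. u t * \<psi> t) \<in> borel_measurable (lebesgue_on {0..T})"
      using m assms(2) by measurable
    show "AE t in lebesgue_on {0..T}. norm (u t * \<psi> t) \<le> norm ((1 + (u t)\<^sup>2) * B)"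
    proof (rule AE_I2)
      fix t assume "t \<in> space (lebesgue_on {0..T})"
      then have t: "\<bar>\<psi> t\<bar> \<le> B" using B by (simp add: space_restrict_space)
      have "\<bar>u t\<bar> \<le> 1 + (u t)\<^sup>2"
        using sum_squares_bound[of 1 "\<bar>u t\<bar>"] by simp
      then have "\<bar>u t\<bar> * \<bar>\<psi> t\<bar> \<le> (1 + (u t)\<^sup>2) * B"
        using t by (intro mult_mono) auto
      then show "norm (u t * \<psi> t) \<le> norm ((1 + (u t)\<^sup>2) * B)"
        by (simp add: abs_mult[symmetric])
    qed
  qed
qed

text \<open>
  The energy is estimated from above rather than expanded: in the open mapping argument, an upper
  bound that depends smoothly on the parameters replaces the energy.
\<close>
lemma L2_control_perturb:
  assumes "T \<ge> 0" and u: "L2_control T u" and "\<psi> \<in> borel_measurable (lebesgue_on {0..T})"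
    and B: "\<And>t. t \<in> {0..T} \<Longrightarrow> \<bar>\<psi> t\<bar> \<le> B"
  shows "L2_control T (\<lambda>t. u t + \<psi> t)"
    and "elastic_energy T (\<lambda>t. u t + \<psi> t)
      \<le> elastic_energy T u + (LINT t|lebesgue_on {0..T}. u t * \<psi> t) + T * B\<^sup>2 / 2"
proof -
  let ?M = "lebesgue_on {0..T}"
  have i: "integrable ?M (\<lambda>t. (u t)\<^sup>2)" using u by (simp add: L2_control_def)
  have c: "integrable ?M (\<lambda>t. c)" for c :: real
    by (rule finite_measure.integrable_const) (simp add: finite_measure_lebesgue_on)
  have i1: "integrable ?M (\<lambda>t. u t * \<psi> t)"
    using L2_control_times_bounded_integrable[OF u assms(3) B] .
  have i2: "integrable ?M (\<lambda>t. (\<psi> t)\<^sup>2)"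
    by (rule Bochner_Integration.integrable_bound[OF c[of "B\<^sup>2"]])
      (use assms(3) B in \<open>auto intro!: AE_I2 simp: space_restrict_space abs_le_square_iff[symmetric]
        intro: order_trans[OF _ abs_ge_self]\<close>)
  have eq: "(u t + \<psi> t)\<^sup>2 = (u t)\<^sup>2 + 2 * (u t * \<psi> t) + (\<psi> t)\<^sup>2" for t
    by (simp add: power2_eq_square algebra_simps)
  show "L2_control T (\<lambda>t. u t + \<psi> t)"
    unfolding L2_control_def eq using u assms(3) i i1 i2
    by (auto simp: L2_control_def intro!: Bochner_Integration.integrable_add)
  have "(LINT t|?M. (u t + \<psi> t)\<^sup>2) \<le> (LINT t|?M. (u t)\<^sup>2 + 2 * (u t * \<psi> t) + B\<^sup>2)"
  proof (rule integral_mono)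
    show "integrable ?M (\<lambda>t. (u t + \<psi> t)\<^sup>2)" 
      unfolding eq using i i1 i2 by (intro Bochner_Integration.integrable_add) auto
    show "integrable ?M (\<lambda>t. (u t)\<^sup>2 + 2 * (u t * \<psi> t) + B\<^sup>2)"
      using i i1 c by (intro Bochner_Integration.integrable_add) auto
    fix t assume "t \<in> space ?M"
    then have "\<bar>\<psi> t\<bar> \<le> \<bar>B\<bar>" using B[of t] by (auto simp: space_restrict_space)
    then have "(\<psi> t)\<^sup>2 \<le> B\<^sup>2" by (simp only: abs_le_square_iff)
    then show "(u t + \<psi> t)\<^sup>2 \<le> (u t)\<^sup>2 + 2 * (u t * \<psi> t) + B\<^sup>2" unfolding eq by simp
  qed
  also have "\<dots> = (LINT t|?M. (u t)\<^sup>2) + 2 * (LINT t|?M. u t * \<psi> t) + T * B\<^sup>2"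
    using i i1 c \<open>T \<ge> 0\<close> by (simp add: measure_restrict_space)
  finally show "elastic_energy T (\<lambda>t. u t + \<psi> t)
      \<le> elastic_energy T u + (LINT t|?M. u t * \<psi> t) + T * B\<^sup>2 / 2"
    unfolding elastic_energy_def by (simp add: field_simps)
qed

text \<open>
  The derivatives, in the direction of \<open>\<phi>\<close>, of the energy and of the two planar
  coordinates of the endpoint.
\<close>
definition first_variation ::
  "real \<Rightarrow> (real \<Rightarrow> real) \<Rightarrow> (real \<Rightarrow> real) \<Rightarrow> (real \<Rightarrow> real) \<Rightarrow> (real \<Rightarrow> real) \<Rightarrow> real \<times> real \<times> real" where
  "first_variation T u \<theta> \<phi> \<psi> =
    (LINT t|lebesgue_on {0..T}. u t * \<psi> t,
     integral {0..T} (\<lambda>t. - sin (\<theta> t) * \<phi> t),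
     integral {0..T} (\<lambda>t. cos (\<theta> t) * \<phi> t))"

lemma first_variation_linear:
  assumes u: "L2_control T u" and \<theta>: "continuous_on {0..T} \<theta>"
    and v: "variation T \<phi> \<psi>" and v': "variation T \<phi>' \<psi>'"
  shows "first_variation T u \<theta> (\<lambda>t. a * \<phi> t + b * \<phi>' t) (\<lambda>t. a * \<psi> t + b * \<psi>' t)
    = a *\<^sub>R first_variation T u \<theta> \<phi> \<psi> + b *\<^sub>R first_variation T u \<theta> \<phi>' \<psi>'"
proof -
  have i: "integrable (lebesgue_on {0..T}) (\<lambda>t. u t * p t)" if "variation T q p" for p q
    using that L2_control_times_bounded_integrable[OF u, of p] unfolding variation_def by blast
  have "(LINT t|lebesgue_on {0..T}. u t * (a * \<psi> t + b * \<psi>' t))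
      = (LINT t|lebesgue_on {0..T}. a * (u t * \<psi> t) + b * (u t * \<psi>' t))"
    by (simp add: algebra_simps)
  also have "\<dots> = a * (LINT t|lebesgue_on {0..T}. u t * \<psi> t) + b * (LINT t|lebesgue_on {0..T}. u t * \<psi>' t)"
    using i[OF v] i[OF v'] by simp
  moreover have "integral {0..T} (\<lambda>t. g t * (a * \<phi> t + b * \<phi>' t))
      = a * integral {0..T} (\<lambda>t. g t * \<phi> t) + b * integral {0..T} (\<lambda>t. g t * \<phi>' t)"
    if g: "continuous_on {0..T} g" for g
  proof -
    have "(\<lambda>t. g t * \<phi> t) integrable_on {0..T}" "(\<lambda>t. g t * \<phi>' t) integrable_on {0..T}"
      by (intro integrable_continuous_interval continuous_intros g variation_continuous_on[OF v]
          variation_continuous_on[OF v'])+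
    then have "((\<lambda>t. a * (g t * \<phi> t) + b * (g t * \<phi>' t)) has_integral
      (a * integral {0..T} (\<lambda>t. g t * \<phi> t) + b * integral {0..T} (\<lambda>t. g t * \<phi>' t))) {0..T}"
      by (intro has_integral_add has_integral_mult_right integrable_integral)
    then show ?thesis by (intro integral_unique) (simp add: algebra_simps)
  qed
  moreover have "continuous_on {0..T} (\<lambda>t. - sin (\<theta> t))" "continuous_on {0..T} (\<lambda>t. cos (\<theta> t))"
    by (intro continuous_intros \<theta>)+
  ultimately show ?thesis
    unfolding first_variation_def by (simp only: scaleR_Pair add_Pair real_scaleR_def)
qed

lemma subspace_first_variations:
  assumes u: "L2_control T u" and \<theta>: "continuous_on {0..T} \<theta>"
  shows "subspace {first_variation T u \<theta> \<phi> \<psi> | \<phi> \<psi>. variation T \<phi> \<psi>}" (is "subspace ?W")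
proof -
  have zero: "variation T (\<lambda>_. 0) (\<lambda>_. 0)"
    by (auto simp: variation_def lipschitz_on_def intro: exI[of _ 0])
  have lin: "a *\<^sub>R v + b *\<^sub>R w \<in> ?W" if vw: "v \<in> ?W" "w \<in> ?W" for a b v w
  proof -
    obtain p q p' q' where v: "variation T p q" "v = first_variation T u \<theta> p q"
      and w: "variation T p' q'" "w = first_variation T u \<theta> p' q'"
      using vw by blast
    have "variation T (\<lambda>t. a * p t + b * p' t) (\<lambda>t. a * q t + b * q' t)"
      using v w by (intro variation_add variation_scale)
    then show ?thesis
      unfolding v(2) w(2) first_variation_linear[OF u \<theta> v(1) w(1), symmetric] by blast
  qed
  have "first_variation T u \<theta> (\<lambda>_. 0) (\<lambda>_. 0) = 0"
    by (simp add: first_variation_def zero_prod_def)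
  then have zeroW: "0 \<in> ?W" using zero by (metis (mono_tags, lifting) mem_Collect_eq)
  show ?thesis
  proof (rule subspaceI)
    show "v + w \<in> ?W" if "v \<in> ?W" "w \<in> ?W" for v w
      using lin[OF that, of 1 1] by (simp only: scaleR_one)
    show "c *\<^sub>R v \<in> ?W" if "v \<in> ?W" for c v
      using lin[OF that that, of c 0] by (simp only: scaleR_zero_left add_0_right)
  qed (fact zeroW)
qed

section \<open>Optimality and Lagrange multipliers\<close>

definition combination :: "(real \<Rightarrow> real) \<Rightarrow> (real \<Rightarrow> real) \<Rightarrow> (real \<Rightarrow> real) \<Rightarrow> real \<times> real \<times> real \<Rightarrow> real \<Rightarrow> real" where
  "combination f g h c t = fst c * f t + fst (snd c) * g t + snd (snd c) * h t"

lemma linear_combination: "linear (\<lambda>c. combination f g h c t)"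
  by (rule linearI) (simp_all add: combination_def algebra_simps)

lemma combination_bound:
  assumes "\<bar>f t\<bar> \<le> B1" "\<bar>g t\<bar> \<le> B2" "\<bar>h t\<bar> \<le> B3"
  shows "\<bar>combination f g h c t\<bar> \<le> (B1 + B2 + B3) * norm c"
proof -
  have n: "\<bar>fst c\<bar> \<le> norm c" "\<bar>fst (snd c)\<bar> \<le> norm c" "\<bar>snd (snd c)\<bar> \<le> norm c"
    using norm_fst_le[of "fst c" "snd c"] norm_snd_le[of "snd c" "fst c"]
      norm_fst_le[of "fst (snd c)" "snd (snd c)"] norm_snd_le[of "snd (snd c)" "fst (snd c)"]
    by auto
  have "\<bar>fst c * f t\<bar> \<le> norm c * B1" "\<bar>fst (snd c) * g t\<bar> \<le> norm c * B2" "\<bar>snd (snd c) * h t\<bar> \<le> norm c * B3"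
    unfolding abs_mult using n assms by (intro mult_mono; simp)+
  then show ?thesis unfolding combination_def by (simp add: algebra_simps)
qed

lemma continuous_on_perturbed_integral:
  fixes \<theta> f g h F :: "real \<Rightarrow> real"
  assumes "continuous_on {0..T} \<theta>" "continuous_on {0..T} f" "continuous_on {0..T} g" "continuous_on {0..T} h"
    and "continuous_on UNIV F"
  shows "continuous_on UNIV (\<lambda>c. integral {0..T} (\<lambda>t. F (\<theta> t + combination f g h c t) - F (\<theta> t)))"
proof -
  have snd: "continuous_on (UNIV \<times> {0..T}) (\<lambda>z :: (real \<times> real \<times> real) \<times> real. k (snd z))"
    if "continuous_on {0..T} k" for k :: "real \<Rightarrow> real"
    by (rule continuous_on_compose2[OF that continuous_on_snd]) auto
  have "continuous_on UNIV (\<lambda>c. integral (cbox 0 T) (\<lambda>t. F (\<theta> t + combination f g h c t) - F (\<theta> t)))"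
    unfolding combination_def
    by (rule integral_continuous_on_param)
      (auto simp: case_prod_beta box_real
        intro!: continuous_intros snd assms(1-4) continuous_on_compose2[OF assms(5)])
  then show ?thesis by (simp add: box_real)
qed

text \<open>
  Choose variations whose first variations are the three basis vectors. The map \<open>H\<close> that
  sends the coefficients of a combination to an upper bound for the change of energy and the
  displacement of the endpoint is continuous and has the identity as derivative at \<open>0\<close>.
  By the open mapping theorem its range is a neighbourhood of \<open>0\<close>, so it
  contains a point with negative first and vanishing other coordinates.
\<close>
lemma energy_decreasing_perturbation:
  assumes "T > 0" and u: "L2_control T u" and \<theta>: "continuous_on {0..T} \<theta>"
    and surj: "{first_variation T u \<theta> \<phi> \<psi> | \<phi> \<psi>. variation T \<phi> \<psi>} = UNIV"
  obtains \<phi> \<psi> where "variation T \<phi> \<psi>"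
    "integral {0..T} (\<lambda>t. cos (\<theta> t + \<phi> t) - cos (\<theta> t)) = 0"
    "integral {0..T} (\<lambda>t. sin (\<theta> t + \<phi> t) - sin (\<theta> t)) = 0"
    "elastic_energy T (\<lambda>t. u t + \<psi> t) < elastic_energy T u"
proof -
  have "\<exists>\<phi> \<psi>. variation T \<phi> \<psi> \<and> first_variation T u \<theta> \<phi> \<psi> = w" for w
  proof -
    have "w \<in> {first_variation T u \<theta> \<phi> \<psi> | \<phi> \<psi>. variation T \<phi> \<psi>}" unfolding surj by simp
    then show ?thesis by blast
  qed
  then obtain p q where pq: "\<And>w. variation T (p w) (q w)" "\<And>w. first_variation T u \<theta> (p w) (q w) = w"
    by metis
  define p1 where "p1 = p (1, 0, 0)"
  define p2 where "p2 = p (0, 1, 0)"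
  define p3 where "p3 = p (0, 0, 1)"
  define q1 where "q1 = q (1, 0, 0)"
  define q2 where "q2 = q (0, 1, 0)"
  define q3 where "q3 = q (0, 0, 1)"
  note var = pq(1)[of "(1,0,0)", folded p1_def q1_def] pq(1)[of "(0,1,0)", folded p2_def q2_def]
    pq(1)[of "(0,0,1)", folded p3_def q3_def]
  note fv = pq(2)[of "(1,0,0)", folded p1_def q1_def] pq(2)[of "(0,1,0)", folded p2_def q2_def]
    pq(2)[of "(0,0,1)", folded p3_def q3_def]
  define \<Phi> where "\<Phi> = combination p1 p2 p3"
  define \<Psi> where "\<Psi> = combination q1 q2 q3"
  have var\<Phi>: "variation T (\<Phi> c) (\<Psi> c)" for c
    unfolding \<Phi>_def \<Psi>_def combination_def by (intro variation_add variation_scale var)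
  have fv\<Phi>: "first_variation T u \<theta> (\<Phi> c) (\<Psi> c) = c" for c
  proof -
    have "first_variation T u \<theta> (\<Phi> c) (\<Psi> c) = fst c *\<^sub>R (1, 0, 0) + fst (snd c) *\<^sub>R (0, 1, 0) + snd (snd c) *\<^sub>R (0, 0, 1)"
    proof -
      have v12: "variation T (\<lambda>t. fst c * p1 t + fst (snd c) * p2 t) (\<lambda>t. fst c * q1 t + fst (snd c) * q2 t)"
        by (intro variation_add variation_scale var)
      show ?thesis
        unfolding \<Phi>_def \<Psi>_def combination_def
        using first_variation_linear[OF u \<theta> v12 var(3), of 1 "snd (snd c)"]
          first_variation_linear[OF u \<theta> var(1) var(2), of "fst c" "fst (snd c)"] fv by simp
    qed
    then show ?thesis by (simp add: prod_eq_iff)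
  qed
  obtain B1 where B1: "B1 \<ge> 0" "\<And>t. t \<in> {0..T} \<Longrightarrow> \<bar>p1 t\<bar> \<le> B1" "\<And>t. t \<in> {0..T} \<Longrightarrow> \<bar>q1 t\<bar> \<le> B1"
    using variation_bounds[OF var(1)] by blast
  obtain B2 where B2: "B2 \<ge> 0" "\<And>t. t \<in> {0..T} \<Longrightarrow> \<bar>p2 t\<bar> \<le> B2" "\<And>t. t \<in> {0..T} \<Longrightarrow> \<bar>q2 t\<bar> \<le> B2"
    using variation_bounds[OF var(2)] by blast
  obtain B3 where B3: "B3 \<ge> 0" "\<And>t. t \<in> {0..T} \<Longrightarrow> \<bar>p3 t\<bar> \<le> B3" "\<And>t. t \<in> {0..T} \<Longrightarrow> \<bar>q3 t\<bar> \<le> B3"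
    using variation_bounds[OF var(3)] by blast
  define B where "B = B1 + B2 + B3"
  have bd: "\<bar>\<Phi> c t\<bar> \<le> B * norm c" "\<bar>\<Psi> c t\<bar> \<le> B * norm c" if "t \<in> {0..T}" for c t
    unfolding \<Phi>_def \<Psi>_def B_def using B1(2,3) B2(2,3) B3(2,3) that
    by (intro combination_bound; simp)+
  \<comment> \<open>The upper bound for the change of energy that is supplied by \<open>L2_control_perturb\<close>.\<close>
  define E where "E c = fst c + (T * B\<^sup>2 / 2) * (norm c)\<^sup>2" for c :: "real \<times> real \<times> real"
  define X where "X c = integral {0..T} (\<lambda>t. cos (\<theta> t + \<Phi> c t) - cos (\<theta> t))" for c
  define Y where "Y c = integral {0..T} (\<lambda>t. sin (\<theta> t + \<Phi> c t) - sin (\<theta> t))" for c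
  define H where "H c = (E c, X c, Y c)" for c
  have lip: "\<bar>sin x - sin y\<bar> \<le> \<bar>x - y\<bar>" "\<bar>(- sin x) - (- sin y)\<bar> \<le> \<bar>x - y\<bar>" "\<bar>cos x - cos y\<bar> \<le> \<bar>x - y\<bar>" for x y :: real
  proof -
    show "\<bar>sin x - sin y\<bar> \<le> \<bar>x - y\<bar>"
      using field_differentiable_bound[of UNIV sin cos 1 x y] by (auto intro: DERIV_sin)
    then show "\<bar>(- sin x) - (- sin y)\<bar> \<le> \<bar>x - y\<bar>" by simp
    show "\<bar>cos x - cos y\<bar> \<le> \<bar>x - y\<bar>"
      using field_differentiable_bound[of UNIV cos "\<lambda>x. - sin x" 1 x y] by (auto intro: DERIV_cos)
  qed
  have contP: "continuous_on {0..T} p1" "continuous_on {0..T} p2" "continuous_on {0..T} p3"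
    "continuous_on {0..T} (\<Phi> c)" for c
    using var var\<Phi> variation_continuous_on by blast+
  have "continuous_on UNIV H"
    unfolding H_def E_def X_def Y_def \<Phi>_def
    by (intro continuous_intros continuous_on_perturbed_integral \<theta> contP)
  moreover have "(H has_derivative id) (at 0)"
  proof -
    have dE: "(E has_derivative fst) (at 0)"
      by (rule quadratic_remainder_has_derivative[where K = "T * B\<^sup>2 / 2"])
        (use \<open>T > 0\<close> in \<open>auto simp: E_def bounded_linear_fst\<close>)
    have lin: "linear (\<lambda>c. \<Phi> c t)" for t unfolding \<Phi>_def by (rule linear_combination)
    have "(X has_derivative (\<lambda>c. integral {0..T} (\<lambda>t. - sin (\<theta> t) * \<Phi> c t))) (at 0)"
      unfolding X_def
      by (rule perturbed_integral_has_derivative[where B = B])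
        (use \<open>T > 0\<close> \<theta> lip lin bd contP DERIV_cos in auto)
    moreover have "(Y has_derivative (\<lambda>c. integral {0..T} (\<lambda>t. cos (\<theta> t) * \<Phi> c t))) (at 0)"
      unfolding Y_def
      by (rule perturbed_integral_has_derivative[where B = B])
        (use \<open>T > 0\<close> \<theta> lip lin bd contP DERIV_sin in auto)
    moreover have "integral {0..T} (\<lambda>t. - sin (\<theta> t) * \<Phi> c t) = fst (snd c)"
      "integral {0..T} (\<lambda>t. cos (\<theta> t) * \<Phi> c t) = snd (snd c)" for c
      using arg_cong[OF fv\<Phi>[of c], of "\<lambda>w. fst (snd w)"] arg_cong[OF fv\<Phi>[of c], of "\<lambda>w. snd (snd w)"]
      unfolding first_variation_def by (simp_all only: fst_conv snd_conv)
    ultimately have "((\<lambda>c. (E c, X c, Y c)) has_derivative (\<lambda>c. (fst c, fst (snd c), snd (snd c)))) (at 0)"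
      using dE by (intro has_derivative_Pair) simp_all
    then show ?thesis unfolding H_def by (simp add: id_def)
  qed
  ultimately have "H 0 \<in> interior (range H)"
    by (intro sussmann_open_mapping[of UNIV H 0 id id UNIV]) (auto simp: id_def)
  moreover have "H 0 = 0"
    by (simp add: H_def E_def X_def Y_def \<Phi>_def combination_def zero_prod_def)
  ultimately obtain e where e: "e > 0" "ball 0 e \<subseteq> range H"
    by (auto simp: mem_interior)
  have "(- (e / 2), 0, 0) \<in> ball (0 :: real \<times> real \<times> real) e"
    using e(1) by (simp add: norm_Pair)
  then obtain c where "H c = (- (e / 2), 0, 0)" using e(2) by force
  then have c: "E c < 0" "X c = 0" "Y c = 0" using e(1) by (auto simp: H_def)
  have m: "\<Psi> c \<in> borel_measurable (lebesgue_on {0..T})" using var\<Phi> by (auto simp: variation_def)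
  have "(LINT t|lebesgue_on {0..T}. u t * \<Psi> c t) = fst c"
    using arg_cong[OF fv\<Phi>[of c], of fst] unfolding first_variation_def by (simp only: fst_conv)
  then have "elastic_energy T (\<lambda>t. u t + \<Psi> c t) \<le> elastic_energy T u + fst c + T * (B * norm c)\<^sup>2 / 2"
    using L2_control_perturb(2)[OF _ u m bd(2)] \<open>T > 0\<close> by simp
  also have "\<dots> = elastic_energy T u + E c" by (simp add: E_def power_mult_distrib)
  finally have "elastic_energy T (\<lambda>t. u t + \<Psi> c t) < elastic_energy T u" using c(1) by simp
  then show thesis using that[OF var\<Phi>] c(2,3) by (simp add: X_def Y_def)
qed

lemma optimal_control_first_variations_proper:
  assumes "T > 0" and traj: "lifted_trajectory T u x y \<theta>"
    and opt: "optimal_control (x 0, y 0, angle (\<theta> 0)) (x T, y T, angle (\<theta> T)) T u"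
  shows "{first_variation T u \<theta> \<phi> \<psi> | \<phi> \<psi>. variation T \<phi> \<psi>} \<noteq> UNIV"
proof
  have u: "L2_control T u"
    using opt by (auto simp: optimal_control_def admissible_control_def)
  have \<theta>: "continuous_on {0..T} \<theta>"
    using traj absolutely_continuous_on_imp_continuous_on by (auto simp: lifted_trajectory_def)
  assume surj: "{first_variation T u \<theta> \<phi> \<psi> | \<phi> \<psi>. variation T \<phi> \<psi>} = UNIV"
  obtain \<phi> \<psi> where var: "variation T \<phi> \<psi>"
    and X: "integral {0..T} (\<lambda>t. cos (\<theta> t + \<phi> t) - cos (\<theta> t)) = 0"
    and Y: "integral {0..T} (\<lambda>t. sin (\<theta> t + \<phi> t) - sin (\<theta> t)) = 0"
    and lt: "elastic_energy T (\<lambda>t. u t + \<psi> t) < elastic_energy T u"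
    using energy_decreasing_perturbation[OF assms(1) u \<theta> surj] .
  have "L2_control T (\<lambda>t. u t + \<psi> t)"
    using L2_control_perturb(1)[OF _ u] var assms(1) unfolding variation_def by (metis less_imp_le)
  moreover have "\<exists>q. trajectory T (\<lambda>t. u t + \<psi> t) q \<and>
    q 0 = (x 0, y 0, angle (\<theta> 0)) \<and> q T = (x T, y T, angle (\<theta> T))"
  proof (intro exI conjI)
    let ?x = "\<lambda>t. x t + integral {0..t} (\<lambda>r. cos (\<theta> r + \<phi> r) - cos (\<theta> r))"
    let ?y = "\<lambda>t. y t + integral {0..t} (\<lambda>r. sin (\<theta> r + \<phi> r) - sin (\<theta> r))"
    show "trajectory T (\<lambda>t. u t + \<psi> t) (\<lambda>t. (?x t, ?y t, angle (\<theta> t + \<phi> t)))"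
      using lifted_trajectory_perturb[OF traj var] unfolding trajectory_def lifted_trajectory_def
      by (intro exI[of _ ?x] exI[of _ ?y] exI[of _ "\<lambda>t. \<theta> t + \<phi> t"]) simp
    show "(?x 0, ?y 0, angle (\<theta> 0 + \<phi> 0)) = (x 0, y 0, angle (\<theta> 0))"
      "(?x T, ?y T, angle (\<theta> T + \<phi> T)) = (x T, y T, angle (\<theta> T))"
      using var X Y by (simp_all add: variation_def)
  qed
  ultimately have "elastic_energy T u \<le> elastic_energy T (\<lambda>t. u t + \<psi> t)"
    using opt unfolding optimal_control_def admissible_control_def by blast
  then show False using lt by simp
qed

text \<open>
  The first variations form a linear subspace; if it is proper, a normal vector
  \<open>(l0, l1, l2)\<close> is a system of Lagrange multipliers.
\<close>
lemma weak_Euler_Lagrange: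
  assumes u: "L2_control T u" and \<theta>: "continuous_on {0..T} \<theta>"
    and proper: "{first_variation T u \<theta> \<phi> \<psi> | \<phi> \<psi>. variation T \<phi> \<psi>} \<noteq> UNIV" (is "?W \<noteq> UNIV")
  obtains l0 l1 l2 where "(l0, l1, l2) \<noteq> (0, 0, 0)"
    "\<And>\<phi> \<psi>. variation T \<phi> \<psi> \<Longrightarrow> l0 * (LINT t|lebesgue_on {0..T}. u t * \<psi> t)
        + integral {0..T} (\<lambda>t. (l2 * cos (\<theta> t) - l1 * sin (\<theta> t)) * \<phi> t) = 0"
proof -
  have span: "span ?W = ?W"
    by (rule span_eq_iff[THEN iffD2, OF subspace_first_variations[OF u \<theta>]])
  have "span ?W \<noteq> UNIV"
    unfolding span by (rule proper)
  then obtain \<nu> where "\<nu> \<noteq> 0" "span ?W \<subseteq> {w. \<nu> \<bullet> w = 0}"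
    using span_not_univ_subset_hyperplane by blast
  then have orth: "\<nu> \<bullet> first_variation T u \<theta> \<phi> \<psi> = 0" if "variation T \<phi> \<psi>" for \<phi> \<psi>
    using that span_superset[of ?W] by blast
  obtain l0 l1 l2 where \<nu>: "\<nu> = (l0, l1, l2)" by (cases \<nu>)
  have "l0 * (LINT t|lebesgue_on {0..T}. u t * \<psi> t)
        + integral {0..T} (\<lambda>t. (l2 * cos (\<theta> t) - l1 * sin (\<theta> t)) * \<phi> t) = 0"
    if var: "variation T \<phi> \<psi>" for \<phi> \<psi>
  proof -
    have "(\<lambda>t. - sin (\<theta> t) * \<phi> t) integrable_on {0..T}" "(\<lambda>t. cos (\<theta> t) * \<phi> t) integrable_on {0..T}"
      by (intro integrable_continuous_interval continuous_intros \<theta> variation_continuous_on[OF var])+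
    then have "((\<lambda>t. l1 * (- sin (\<theta> t) * \<phi> t) + l2 * (cos (\<theta> t) * \<phi> t)) has_integral
        l1 * integral {0..T} (\<lambda>t. - sin (\<theta> t) * \<phi> t) + l2 * integral {0..T} (\<lambda>t. cos (\<theta> t) * \<phi> t)) {0..T}"
      by (intro has_integral_add has_integral_mult_right integrable_integral)
    then have "integral {0..T} (\<lambda>t. (l2 * cos (\<theta> t) - l1 * sin (\<theta> t)) * \<phi> t)
      = l1 * integral {0..T} (\<lambda>t. - sin (\<theta> t) * \<phi> t) + l2 * integral {0..T} (\<lambda>t. cos (\<theta> t) * \<phi> t)"
      by (intro integral_unique) (simp add: algebra_simps)
    then show ?thesis
      using orth[OF var] unfolding \<nu> first_variation_def inner_Pair by simp
  qed
  then show thesis using that[of l0 l1 l2] \<open>\<nu> \<noteq> 0\<close> \<nu> by (simp add: zero_prod_def)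
qed

section \<open>Regularity of the angle\<close>

lemma lipschitz_imp_derivative_bounded:
  fixes f :: "real \<Rightarrow> real"
  assumes "a < b" and lip: "L-lipschitz_on {a..b} f" and t: "t \<in> {a..b}"
    and der: "(f has_real_derivative D) (at t within {a..b})"
  shows "\<bar>D\<bar> \<le> L"
proof -
  have "((\<lambda>s. (f s - f t) / (s - t)) \<longlongrightarrow> D) (at t within {a..b})"
    using der by (simp add: has_field_derivative_iff)
  then have lim: "((\<lambda>s. \<bar>(f s - f t) / (s - t)\<bar>) \<longlongrightarrow> \<bar>D\<bar>) (at t within {a..b})"
    by (rule tendsto_rabs)
  show ?thesis
  proof (rule tendsto_upperbound[OF lim])
    show "\<forall>\<^sub>F s in at t within {a..b}. \<bar>(f s - f t) / (s - t)\<bar> \<le> L"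
      unfolding eventually_at_filter
    proof (rule always_eventually, intro allI impI)
      fix s assume "s \<noteq> t" "s \<in> {a..b}"
      then show "\<bar>(f s - f t) / (s - t)\<bar> \<le> L"
        using lipschitz_onD[OF lip _ t, of s] by (simp add: dist_real_def field_simps)
    qed
    show "at t within {a..b} \<noteq> bot"
      using assms(1) t by (simp add: trivial_limit_within islimpt_Icc)
  qed
qed

text \<open>
  This settles the abnormal case. The function \<open>l2 * cos \<theta> - l1 * sin \<theta>\<close> and
  its derivative with respect to \<open>\<theta>\<close> have squares adding up to
  \<open>l1^2 + l2^2\<close>. If the former vanishes identically, the latter does not vanish, and
  the chain rule forces the angular velocity to be zero.
\<close>
lemma constant_direction_imp_derivative_zero:
  fixes \<theta> :: "real \<Rightarrow> real"
  assumes "(l1, l2) \<noteq> (0, 0)"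
    and h0: "\<And>t. t \<in> {a<..<b} \<Longrightarrow> l2 * cos (\<theta> t) - l1 * sin (\<theta> t) = 0"
    and der: "(\<theta> has_real_derivative D) (at t within {a..b})" and t: "t \<in> {a<..<b}"
  shows "D = 0"
proof -
  have "((\<lambda>t. l2 * cos (\<theta> t) - l1 * sin (\<theta> t)) has_real_derivative
      (- l1 * cos (\<theta> t) - l2 * sin (\<theta> t)) * D) (at t within {a..b})"
    using der by (auto intro!: derivative_eq_intros simp: algebra_simps)
  then have "((\<lambda>t. l2 * cos (\<theta> t) - l1 * sin (\<theta> t)) has_real_derivative
      (- l1 * cos (\<theta> t) - l2 * sin (\<theta> t)) * D) (at t)"
    using t by (simp add: at_within_Icc_at)
  moreover have "((\<lambda>t. l2 * cos (\<theta> t) - l1 * sin (\<theta> t)) has_real_derivative 0) (at t)"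
    by (rule has_field_derivative_transform_within_open[OF DERIV_const open_greaterThanLessThan t])
      (rule h0[symmetric])
  ultimately have "(- l1 * cos (\<theta> t) - l2 * sin (\<theta> t)) * D = 0" by (rule DERIV_unique)
  moreover have "- l1 * cos (\<theta> t) - l2 * sin (\<theta> t) \<noteq> 0"
  proof
    assume *: "- l1 * cos (\<theta> t) - l2 * sin (\<theta> t) = 0"
    have "(- l1 * c - l2 * s)\<^sup>2 + (l2 * c - l1 * s)\<^sup>2 = (l1\<^sup>2 + l2\<^sup>2) * (s\<^sup>2 + c\<^sup>2)" for c s
      by (simp add: power2_eq_square algebra_simps)
    from this[of "cos (\<theta> t)" "sin (\<theta> t)"] have "l1\<^sup>2 + l2\<^sup>2 = 0" using * h0[OF t] by simp
    then show False using assms(1) by (simp add: sum_power2_eq_zero_iff)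
  qed
  ultimately show ?thesis by simp
qed

text \<open>
  This settles the normal case. Testing with the Green functions turns the weak
  Euler--Lagrange equation into the representation of \<open>\<theta>\<close> as an affine function
  minus \<open>G / l0\<close>, where \<open>G s\<close> is the integral of \<open>h\<close> against
  \<open>green T s\<close>. The kernel is Lipschitz in \<open>s\<close> and \<open>h\<close> is
  bounded, so \<open>G\<close> and hence \<open>\<theta>\<close> are Lipschitz.
\<close>
lemma Euler_Lagrange_imp_lipschitz:
  fixes h \<theta> u :: "real \<Rightarrow> real"
  assumes "T > 0" "l0 \<noteq> 0" and u: "L2_control T u" and h: "continuous_on {0..T} h"
    and ac: "absolutely_continuous_on {0..T} \<theta>" and N: "negligible N"
    and der: "\<And>t. t \<in> {0..T} - N \<Longrightarrow> (\<theta> has_real_derivative u t) (at t within {0..T})"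
    and EL: "\<And>\<phi> \<psi>. variation T \<phi> \<psi> \<Longrightarrow>
      l0 * (LINT t|lebesgue_on {0..T}. u t * \<psi> t) + integral {0..T} (\<lambda>t. h t * \<phi> t) = 0"
  shows "\<exists>L. L-lipschitz_on {0..T} \<theta>"
proof -
  obtain A where A: "A \<ge> 0" "\<And>t. t \<in> {0..T} \<Longrightarrow> norm (h t) \<le> A"
    using continuous_on_compact_bound[OF compact_Icc h] by blast
  have LINT_u: "(LINT t|lebesgue_on {0..T}. u t * ((if t < s then 1 else 0) - s / T))
      = \<theta> s - \<theta> 0 - s / T * (\<theta> T - \<theta> 0)" if s: "s \<in> {0..T}" for s
  proof -
    have "integrable (lebesgue_on {0..T}) (\<lambda>t. u t * ((if t < s then 1 else 0) - s / T))"
      using variation_green[OF assms(1) s]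
        L2_control_times_bounded_integrable[OF u, of "\<lambda>t. (if t < s then 1 else 0) - s / T"]
      unfolding variation_def by blast
    then have "(LINT t|lebesgue_on {0..T}. u t * ((if t < s then 1 else 0) - s / T))
        = integral {0..T} (\<lambda>t. u t * ((if t < s then 1 else 0) - s / T))"
      by (rule lebesgue_integral_eq_integral) simp
    also have "\<dots> = \<theta> s - \<theta> 0 - s / T * (\<theta> T - \<theta> 0)"
    proof (rule integral_unique)
      have i0: "(u has_integral (\<theta> r - \<theta> 0)) {0..r}" if r: "r \<in> {0..T}" for r
      proof (rule has_integral_derivative_absolutely_continuous[OF _ _ N])
        show "absolutely_continuous_on {0..r} \<theta>"
          using absolutely_continuous_on_subset[OF ac] r by auto
        show "(\<theta> has_real_derivative u t) (at t within {0..r})" if "t \<in> {0..r} - N" for t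
          using der[of t] that r by (auto intro: has_field_derivative_subset)
      qed (use r in auto)
      have "((\<lambda>t. if t \<in> {0..s} then u t else 0) has_integral (\<theta> s - \<theta> 0)) {0..T}"
        using i0[OF s] s by (subst has_integral_restrict) auto
      then have "((\<lambda>t. if t < s then u t else 0) has_integral (\<theta> s - \<theta> 0)) {0..T}"
        by (rule has_integral_spike_finite[of "{s}", rotated 2]) auto
      then have "((\<lambda>t. (if t < s then u t else 0) - s / T * u t) has_integral
          (\<theta> s - \<theta> 0 - s / T * (\<theta> T - \<theta> 0))) {0..T}"
        using i0[of T] assms(1) by (intro has_integral_diff has_integral_mult_right) auto
      then show "((\<lambda>t. u t * ((if t < s then 1 else 0) - s / T)) has_integral
          (\<theta> s - \<theta> 0 - s / T * (\<theta> T - \<theta> 0))) {0..T}"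
        by (rule has_integral_eq[rotated]) (simp add: algebra_simps)
    qed
    finally show ?thesis .
  qed
  define G where "G s = integral {0..T} (\<lambda>t. h t * green T s t)" for s
  have \<theta>G: "\<theta> s = \<theta> 0 + s / T * (\<theta> T - \<theta> 0) - G s / l0" if s: "s \<in> {0..T}" for s
    using EL[OF variation_green[OF assms(1) s]] \<open>l0 \<noteq> 0\<close> unfolding LINT_u[OF s] G_def[symmetric]
    by (simp add: field_simps)
  have G_lip: "\<bar>G s - G r\<bar> \<le> 2 * A * T * \<bar>s - r\<bar>" for s r
  proof -
    have int: "(\<lambda>t. h t * green T s t) integrable_on {0..T}" for s
      by (intro integrable_continuous_interval continuous_intros h continuous_on_green)
    have "G s - G r = integral {0..T} (\<lambda>t. h t * (green T s t - green T r t))"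
      by (simp add: G_def integral_diff[OF int int, symmetric] algebra_simps)
    moreover have "norm (integral {0..T} (\<lambda>t. h t * (green T s t - green T r t)))
        \<le> (A * (2 * \<bar>s - r\<bar>)) * (T - 0)"
    proof (rule integral_bound)
      fix t assume t: "t \<in> {0..T}"
      have "\<bar>green T s t - green T r t\<bar> \<le> 2 * \<bar>s - r\<bar>"
        using green_lipschitz[OF assms(1) t] by (simp add: green_commute[of T _ t])
      then show "norm (h t * (green T s t - green T r t)) \<le> A * (2 * \<bar>s - r\<bar>)"
        using A(2)[OF t] A(1) unfolding norm_mult by (intro mult_mono) auto
    qed (use assms(1) in \<open>auto intro!: continuous_intros h continuous_on_green\<close>)
    ultimately show ?thesis by (simp add: mult_ac)
  qed
  define L where "L = \<bar>(\<theta> T - \<theta> 0) / T\<bar> + 2 * A * T / \<bar>l0\<bar>"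
  have "L-lipschitz_on {0..T} \<theta>"
  proof (rule lipschitz_onI)
    show "0 \<le> L" using A(1) assms(1) by (simp add: L_def)
    fix s r assume s: "s \<in> {0..T}" and r: "r \<in> {0..T}"
    have "\<theta> s - \<theta> r = (\<theta> T - \<theta> 0) / T * (s - r) - (G s - G r) / l0"
      by (subst \<theta>G[OF s], subst \<theta>G[OF r]) (simp add: diff_divide_distrib algebra_simps)
    then have "\<bar>\<theta> s - \<theta> r\<bar> \<le> \<bar>(\<theta> T - \<theta> 0) / T * (s - r)\<bar> + \<bar>(G s - G r) / l0\<bar>"
      by (simp only: abs_triangle_ineq4)
    also have "\<dots> = \<bar>(\<theta> T - \<theta> 0) / T\<bar> * \<bar>s - r\<bar> + \<bar>G s - G r\<bar> / \<bar>l0\<bar>"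
      by (simp only: abs_mult abs_divide)
    also have "\<dots> \<le> \<bar>(\<theta> T - \<theta> 0) / T\<bar> * \<bar>s - r\<bar> + 2 * A * T * \<bar>s - r\<bar> / \<bar>l0\<bar>"
      using G_lip[of s r] by (intro add_left_mono divide_right_mono) auto
    also have "\<dots> = L * \<bar>s - r\<bar>" by (simp add: L_def algebra_simps)
    finally show "dist (\<theta> s) (\<theta> r) \<le> L * dist s r" by (simp add: dist_real_def)
  qed
  then show ?thesis by blast
qed

theorem theorem6p2:
  fixes q0 q1 :: config and t1 :: real and u :: "real \<Rightarrow> real"
  assumes "t1 > 0"
    and "q1 \<in> attainable_set q0 t1"
    and "optimal_control q0 q1 t1 u"
  shows "essentially_bounded t1 u"
proof -
  have u: "L2_control t1 u"
    using assms(3) by (auto simp: optimal_control_def admissible_control_def)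
  obtain q where q: "trajectory t1 u q" "q 0 = q0" "q t1 = q1"
    using assms(3) unfolding optimal_control_def admissible_control_def by blast
  then obtain x y \<theta> where lift: "\<And>t. t \<in> {0..t1} \<Longrightarrow> q t = (x t, y t, angle (\<theta> t))"
    and traj: "lifted_trajectory t1 u x y \<theta>"
    unfolding trajectory_def lifted_trajectory_def by blast
  have "q0 = (x 0, y 0, angle (\<theta> 0))" "q1 = (x t1, y t1, angle (\<theta> t1))"
    using lift[of 0] lift[of t1] q(2,3) assms(1) by auto
  then have proper: "{first_variation t1 u \<theta> \<phi> \<psi> | \<phi> \<psi>. variation t1 \<phi> \<psi>} \<noteq> UNIV"
    using optimal_control_first_variations_proper[OF assms(1) traj] assms(3) by simp
  have \<theta>ac: "absolutely_continuous_on {0..t1} \<theta>" using traj by (simp add: lifted_trajectory_def)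
  then have \<theta>: "continuous_on {0..t1} \<theta>" by (rule absolutely_continuous_on_imp_continuous_on)
  have AE: "AE t in lebesgue_on {0..t1}. (\<theta> has_real_derivative u t) (at t within {0..t1})"
    using traj by (auto simp: lifted_trajectory_def)
  \<comment> \<open>The endpoints are added because the abnormal case is treated at interior times.\<close>
  define N where "N = {t \<in> {0..t1}. \<not> (\<theta> has_real_derivative u t) (at t within {0..t1})} \<union> {0, t1}"
  have N: "negligible N"
    unfolding N_def using AE by (simp add: AE_lebesgue_on_iff_negligible negligible_Un)
  have der: "(\<theta> has_real_derivative u t) (at t within {0..t1})" "t \<in> {0<..<t1}" if "t \<in> {0..t1} - N" for t
    using that by (auto simp: N_def)
  obtain l0 l1 l2 where l: "(l0, l1, l2) \<noteq> (0, 0, 0)"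
    and EL: "\<And>\<phi> \<psi>. variation t1 \<phi> \<psi> \<Longrightarrow> l0 * (LINT t|lebesgue_on {0..t1}. u t * \<psi> t)
        + integral {0..t1} (\<lambda>t. (l2 * cos (\<theta> t) - l1 * sin (\<theta> t)) * \<phi> t) = 0"
    using weak_Euler_Lagrange[OF u \<theta> proper] by blast
  have h: "continuous_on {0..t1} (\<lambda>t. l2 * cos (\<theta> t) - l1 * sin (\<theta> t))"
    by (intro continuous_intros \<theta>)
  have "\<exists>C. \<forall>t\<in>{0..t1} - N. \<bar>u t\<bar> \<le> C"
  proof (cases "l0 = 0")
    case True
    have "l2 * cos (\<theta> t) - l1 * sin (\<theta> t) = 0" if "t \<in> {0<..<t1}" for t
      using EL[OF variation_green[OF assms(1)]] that True
      by (intro orthogonal_green_imp_zero[OF assms(1) h]) auto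
    then have "u t = 0" if "t \<in> {0..t1} - N" for t
      using constant_direction_imp_derivative_zero[OF _ _ der[OF that], of l1 l2] l True by auto
    then show ?thesis by (intro exI[of _ 0]) simp
  next
    case False
    then obtain L where "L-lipschitz_on {0..t1} \<theta>"
      using Euler_Lagrange_imp_lipschitz[OF assms(1) False u h \<theta>ac N der(1) EL] by blast
    then show ?thesis
      using lipschitz_imp_derivative_bounded[OF assms(1)] der(1) by blast
  qed
  then obtain C where C: "\<forall>t\<in>{0..t1} - N. \<bar>u t\<bar> \<le> C" by blast
  have "negligible {t \<in> {0..t1}. \<not> \<bar>u t\<bar> \<le> C}"
    by (rule negligible_subset[OF N]) (use C in auto)
  then show ?thesis
    unfolding essentially_bounded_def by (subst AE_lebesgue_on_iff_negligible) auto
qed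

end
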